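(* Let $(W,S)$ be a Coxeter system, let $I,J\subset S$ be finitary and let $p$ be a $(J,I)$-coset, with $M=\mathrm{LD}(\overline p)$ and $N=\mathrm{RD}(\overline p)$. Let $q$ be the $(M,N)$-coset with $\overline q=\overline p$. If $I_\bullet$ is any reduced expression for $q$, then $[[J,M]]\circ I_\bullet\circ[[N,I]]$ is a reduced expression for $p$.
   Context: Let $(W,S)$ be a Coxeter system with identity $e$, length $\ell_W$ and Bruhat order $\le$. For $w\in W$, $\mathrm{LD}(w)=\{s\in S:\ell_W(sw)<\ell_W(w)\}$ and $\mathrm{RD}(w)=\{s\in S:\ell_W(ws)<\ell_W(w)\}$ are the left and right descent sets. For $I\subset S$ let $W_I$ be the parabolic subgroup generated by $I$; $I$ is finitary if $W_I$ is finite (descent sets are always finitary). For finitary $I,J$, a $(J,I)$-coset is a double coset $p\in W_J\backslash W/W_I$ (the pair $(J,I)$ is part of the data); it has a unique Bruhat-maximal element $\overline{p}$ and a unique Bruhat-minimal element $\underline{p}$, and $J\subset\mathrm{LD}(\overline p)$, $I\subset\mathrm{RD}(\overline p)$. A (singular) expression is a sequence $[I_0,\dots,I_d]$ of finitary subsets of $S$, consecutive ones differing by adding or removing exactly one element of $S$. Its forward path is the sequence $p_0,\dots,p_d$ where $p_i$ is an $(I_0,I_i)$-coset, $e\in p_0$; if $I_i\subset I_{i+1}$, $p_{i+1}$ is the $(I_0,I_{i+1})$-coset containing $p_i$; if $I_i\supset I_{i+1}$, $p_{i+1}$ is the $(I_0,I_{i+1})$-coset containing $\overline{p_i}$. It is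 an expression for $p_d$. Put $K_i=I_0\cap\underline{p_i}I_i\underline{p_i}^{-1}$. The expression is reduced if for every $i$ with $I_i\subset I_{i+1}$ one has $\underline{p_i}=\underline{p_{i+1}}$ and $K_i=K_{i+1}$. For $J\subset M$, $[[J,M]]$ denotes any expression from $J$ to $M$ that adds the elements of $M\setminus J$ one at a time; for $N\supset I$, $[[N,I]]$ denotes any expression from $N$ to $I$ that removes the elements of $N\setminus I$ one at a time. $\circ$ denotes concatenation of expressions (identifying the last set of one with the first of the next). *)

theory Defs
  imports "HOL-Algebra.Algebra"
begin

section \<open>Coxeter systems\<close>

text \<open>A Coxeter matrix takes values in the positive integers and infinity; the value
  infinity (no relation between \<open>s\<close> and \<open>t\<close>) is encoded as \<open>0\<close>, which
  makes the relator \<open>(st)^0\<close> the empty word.\<close>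

definition coxeter_matrix :: "'a set \<Rightarrow> ('a \<Rightarrow> 'a \<Rightarrow> nat) \<Rightarrow> bool" where
  "coxeter_matrix S m \<longleftrightarrow>
     (\<forall>s\<in>S. m s s = 1) \<and>
     (\<forall>s\<in>S. \<forall>t\<in>S. m s t = m t s \<and> (s \<noteq> t \<longrightarrow> m s t \<noteq> 1))"

definition relator :: "('a \<Rightarrow> 'a \<Rightarrow> nat) \<Rightarrow> 'a \<Rightarrow> 'a \<Rightarrow> 'a list" where
  "relator m s t = concat (replicate (m s t) [s, t])"

text \<open>Equality of words in the group presented by \<open>S\<close> and the relators: words are related
  iff one is obtained from the other by finitely many insertions and deletions of relators.
  As \<open>ss\<close> is a relator for every \<open>s\<close>, positive words suffice.\<close>

inductive coxeter_cong :: "'a set \<Rightarrow> ('a \<Rightarrow> 'a \<Rightarrow> nat) \<Rightarrow> 'a list \<Rightarrow> 'a list \<Rightarrow> bool"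
  for S m where
  relator: "\<lbrakk>u \<in> lists S; v \<in> lists S; s \<in> S; t \<in> S\<rbrakk>
              \<Longrightarrow> coxeter_cong S m (u @ relator m s t @ v) (u @ v)"
| refl: "u \<in> lists S \<Longrightarrow> coxeter_cong S m u u"
| sym: "coxeter_cong S m u v \<Longrightarrow> coxeter_cong S m v u"
| trans: "\<lbrakk>coxeter_cong S m u v; coxeter_cong S m v w\<rbrakk> \<Longrightarrow> coxeter_cong S m u w"

definition word_prod :: "('a, 'b) monoid_scheme \<Rightarrow> 'a list \<Rightarrow> 'a" where
  "word_prod G ws = foldr (\<lambda>x y. x \<otimes>\<^bsub>G\<^esub> y) ws \<one>\<^bsub>G\<^esub>"

text \<open>\<open>G\<close> is generated by \<open>S\<close> and presented by the Coxeter relations of some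
  Coxeter matrix. The set \<open>S\<close> may be infinite.\<close>

definition coxeter_system :: "('a, 'b) monoid_scheme \<Rightarrow> 'a set \<Rightarrow> bool" where
  "coxeter_system G S \<longleftrightarrow>
     group G \<and> S \<subseteq> carrier G \<and> generate G S = carrier G \<and>
     (\<exists>m. coxeter_matrix S m \<and>
          (\<forall>u\<in>lists S. \<forall>v\<in>lists S. word_prod G u = word_prod G v \<longleftrightarrow> coxeter_cong S m u v))"

definition coxeter_length :: "('a, 'b) monoid_scheme \<Rightarrow> 'a set \<Rightarrow> 'a \<Rightarrow> nat" where
  "coxeter_length G S w = (LEAST n. \<exists>ws\<in>lists S. length ws = n \<and> word_prod G ws = w)"

definition reflections :: "('a, 'b) monoid_scheme \<Rightarrow> 'a set \<Rightarrow> 'a set" where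
  "reflections G S = {w \<otimes>\<^bsub>G\<^esub> s \<otimes>\<^bsub>G\<^esub> inv\<^bsub>G\<^esub> w | w s. w \<in> carrier G \<and> s \<in> S}"

definition bruhat_step :: "('a, 'b) monoid_scheme \<Rightarrow> 'a set \<Rightarrow> 'a \<Rightarrow> 'a \<Rightarrow> bool" where
  "bruhat_step G S u w \<longleftrightarrow>
     u \<in> carrier G \<and> (\<exists>t\<in>reflections G S. w = u \<otimes>\<^bsub>G\<^esub> t) \<and>
     coxeter_length G S u < coxeter_length G S w"

definition bruhat_le :: "('a, 'b) monoid_scheme \<Rightarrow> 'a set \<Rightarrow> 'a \<Rightarrow> 'a \<Rightarrow> bool" where
  "bruhat_le G S = (bruhat_step G S)\<^sup>*\<^sup>*"

definition left_descents :: "('a, 'b) monoid_scheme \<Rightarrow> 'a set \<Rightarrow> 'a \<Rightarrow> 'a set" where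
  "left_descents G S w = {s \<in> S. coxeter_length G S (s \<otimes>\<^bsub>G\<^esub> w) < coxeter_length G S w}"

definition right_descents :: "('a, 'b) monoid_scheme \<Rightarrow> 'a set \<Rightarrow> 'a \<Rightarrow> 'a set" where
  "right_descents G S w = {s \<in> S. coxeter_length G S (w \<otimes>\<^bsub>G\<^esub> s) < coxeter_length G S w}"

definition finitary :: "('a, 'b) monoid_scheme \<Rightarrow> 'a set \<Rightarrow> 'a set \<Rightarrow> bool" where
  "finitary G S I \<longleftrightarrow> I \<subseteq> S \<and> finite (generate G I)"


section \<open>Double cosets\<close>

text \<open>The underlying sets of the \<open>(J,I)\<close>-cosets. The pair \<open>(J,I)\<close> belongs to the data
  of a coset but cannot be recovered from the underlying set, so it is passed
  alongside wherever it matters.\<close>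

definition double_cosets :: "('a, 'b) monoid_scheme \<Rightarrow> 'a set \<Rightarrow> 'a set \<Rightarrow> 'a set set" where
  "double_cosets G J I =
     {generate G J <#>\<^bsub>G\<^esub> {w} <#>\<^bsub>G\<^esub> generate G I | w. w \<in> carrier G}"

text \<open>The Bruhat-maximal and Bruhat-minimal elements of a double coset exist and are unique when
  \<open>J\<close> and \<open>I\<close> are finitary.\<close>

definition coset_max :: "('a, 'b) monoid_scheme \<Rightarrow> 'a set \<Rightarrow> 'a set \<Rightarrow> 'a" where
  "coset_max G S p = (THE w. w \<in> p \<and> (\<forall>u\<in>p. bruhat_le G S w u \<longrightarrow> u = w))"

definition coset_min :: "('a, 'b) monoid_scheme \<Rightarrow> 'a set \<Rightarrow> 'a set \<Rightarrow> 'a" where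
  "coset_min G S p = (THE w. w \<in> p \<and> (\<forall>u\<in>p. bruhat_le G S u w \<longrightarrow> u = w))"


section \<open>Singular expressions\<close>

definition expression :: "('a, 'b) monoid_scheme \<Rightarrow> 'a set \<Rightarrow> 'a set list \<Rightarrow> bool" where
  "expression G S Is \<longleftrightarrow>
     Is \<noteq> [] \<and> (\<forall>I\<in>set Is. finitary G S I) \<and>
     (\<forall>i. Suc i < length Is \<longrightarrow>
        (\<exists>s\<in>S. s \<notin> Is ! i \<and> Is ! Suc i = insert s (Is ! i) \<or>
               s \<notin> Is ! Suc i \<and> Is ! i = insert s (Is ! Suc i)))"

definition forward_path ::
  "('a, 'b) monoid_scheme \<Rightarrow> 'a set \<Rightarrow> 'a set list \<Rightarrow> 'a set list \<Rightarrow> bool" where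
  "forward_path G S Is ps \<longleftrightarrow>
     length ps = length Is \<and>
     (\<forall>i < length Is. ps ! i \<in> double_cosets G (Is ! 0) (Is ! i)) \<and>
     \<one>\<^bsub>G\<^esub> \<in> ps ! 0 \<and>
     (\<forall>i. Suc i < length Is \<longrightarrow>
        (Is ! i \<subset> Is ! Suc i \<longrightarrow> ps ! i \<subseteq> ps ! Suc i) \<and>
        (Is ! Suc i \<subset> Is ! i \<longrightarrow> coset_max G S (ps ! i) \<in> ps ! Suc i))"

text \<open>\<open>Is\<close> is an expression for the \<open>(J,I)\<close>-coset \<open>p\<close>.\<close>

definition expression_for ::
  "('a, 'b) monoid_scheme \<Rightarrow> 'a set \<Rightarrow> 'a set list \<Rightarrow> 'a set \<Rightarrow> 'a set \<Rightarrow> 'a set \<Rightarrow> bool" where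
  "expression_for G S Is J I p \<longleftrightarrow>
     expression G S Is \<and> hd Is = J \<and> last Is = I \<and>
     (\<exists>ps. forward_path G S Is ps \<and> last ps = p)"

text \<open>The set \<open>J \<inter> x I x\<^sup>-\<^sup>1\<close>, where \<open>x\<close> is the minimal element of \<open>p\<close>.\<close>

definition left_redundancy ::
  "('a, 'b) monoid_scheme \<Rightarrow> 'a set \<Rightarrow> 'a set \<Rightarrow> 'a set \<Rightarrow> 'a set \<Rightarrow> 'a set" where
  "left_redundancy G S J I p =
     J \<inter> (\<lambda>s. coset_min G S p \<otimes>\<^bsub>G\<^esub> s \<otimes>\<^bsub>G\<^esub> inv\<^bsub>G\<^esub> (coset_min G S p)) ` I"

definition reduced_expression :: "('a, 'b) monoid_scheme \<Rightarrow> 'a set \<Rightarrow> 'a set list \<Rightarrow> bool" where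
  "reduced_expression G S Is \<longleftrightarrow>
     expression G S Is \<and>
     (\<exists>ps. forward_path G S Is ps \<and>
        (\<forall>i. Suc i < length Is \<and> Is ! i \<subset> Is ! Suc i \<longrightarrow>
           coset_min G S (ps ! i) = coset_min G S (ps ! Suc i) \<and>
           left_redundancy G S (Is ! 0) (Is ! i) (ps ! i) =
             left_redundancy G S (Is ! 0) (Is ! Suc i) (ps ! Suc i)))"

text \<open>The expressions denoted by \<open>[[J,M]]\<close> for \<open>J \<subseteq> M\<close>, and by \<open>[[N,I]]\<close>
  for \<open>I \<subseteq> N\<close>, respectively.\<close>

definition ascending_expression ::
  "('a, 'b) monoid_scheme \<Rightarrow> 'a set \<Rightarrow> 'a set \<Rightarrow> 'a set \<Rightarrow> 'a set list \<Rightarrow> bool" where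
  "ascending_expression G S J M Is \<longleftrightarrow>
     expression G S Is \<and> hd Is = J \<and> last Is = M \<and>
     (\<forall>i. Suc i < length Is \<longrightarrow> Is ! i \<subset> Is ! Suc i)"

definition descending_expression ::
  "('a, 'b) monoid_scheme \<Rightarrow> 'a set \<Rightarrow> 'a set \<Rightarrow> 'a set \<Rightarrow> 'a set list \<Rightarrow> bool" where
  "descending_expression G S N I Is \<longleftrightarrow>
     expression G S Is \<and> hd Is = N \<and> last Is = I \<and>
     (\<forall>i. Suc i < length Is \<longrightarrow> Is ! Suc i \<subset> Is ! i)"

text \<open>Used only when \<open>last Is = hd Js\<close>.\<close>

definition expr_concat :: "'a set list \<Rightarrow> 'a set list \<Rightarrow> 'a set list" (infixr "\<circ>\<^sub>e" 65) where
  "Is \<circ>\<^sub>e Js = Is @ tl Js"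

end

theory Submission
  imports Defs "HOL-Library.Sublist"
begin

text \<open>The idea is to follow longest elements. The longest element of a double coset
  \<open>W\<^sub>J w W\<^sub>I\<close> is its only element with all of \<open>J\<close> among the left and all of
  \<open>I\<close> among the right descents. If \<open>J \<subseteq> M\<close>, a \<open>(J,I)\<close>-coset that contains
  the longest element \<open>z\<close> of an \<open>(M,I)\<close>-coset therefore has the same longest element
  \<open>z\<close>. Running the expression for \<open>q\<close> from the coset \<open>W\<^sub>M\<close>, once with
  \<open>W\<^sub>M\<close> and once with \<open>W\<^sub>J\<close> acting on the left, produces two paths with equal
  longest elements: a descending step keeps the longest element, and an ascending step to
  \<open>I'\<close> replaces \<open>z\<close> by the longest element of \<open>z W\<^sub>I\<^sub>'\<close>
  (\<open>longest_extends_right\<close>).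

  Reducedness is formulated through shortest elements and left redundancies, which do change when
  \<open>M\<close> is replaced by \<open>J\<close>. The key is that an ascending step from \<open>I\<close> to
  \<open>I'\<close> at a coset with longest element \<open>z\<close> is reduced if and only if the shortest
  element of \<open>z W\<^sub>I\<close> is also shortest in \<open>z W\<^sub>I\<^sub>'\<close>
  (\<open>reduced_step_imp_rep_minimal\<close> and \<open>rep_minimal_imp_reduced_step\<close>). This
  criterion involves \<open>z\<close> alone, so reducedness passes from the path of \<open>(M,_)\<close>-cosets
  to the path of \<open>(J,_)\<close>-cosets (\<open>transfer_reduced_path\<close>).

  The initial part from \<open>J\<close> up to \<open>M\<close> is reduced because all its cosets have shortest
  element \<open>1\<close>. The final part from \<open>N\<close> down to \<open>I\<close> has no ascending step
  and does not change the longest element, which is that of \<open>q\<close>, hence that of \<open>p\<close>.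
  So the path ends in the \<open>(J,I)\<close>-coset of that element, which is \<open>p\<close>.

  The facts about double cosets come from the exchange and deletion conditions, which are derived
  from the presentation by counting the reflections of a word modulo two.\<close>


section \<open>Words in a Coxeter system\<close>

lemma subseq_rev: "subseq xs ys \<Longrightarrow> subseq (rev xs) (rev ys)"
  by (induction rule: list_emb.induct) (auto intro: list_emb_append_mono)

locale coxeter = group G for G (structure) +
  fixes S
  assumes coxeter: "coxeter_system G S"
begin

abbreviation len where "len \<equiv> coxeter_length G S"
abbreviation wp where "wp \<equiv> word_prod G"

lemma S_subset: "S \<subseteq> carrier G"
  using coxeter by (simp add: coxeter_system_def)

lemma S_closed [simp]: "s \<in> S \<Longrightarrow> s \<in> carrier G"
  using S_subset by blast

lemma wp_Nil [simp]: "wp [] = \<one>" and wp_Cons [simp]: "wp (s # ws) = s \<otimes> wp ws"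
  by (simp_all add: word_prod_def)

lemma wp_closed [simp]: "set ws \<subseteq> S \<Longrightarrow> wp ws \<in> carrier G"
  by (induction ws) auto

lemma wp_append [simp]:
  "\<lbrakk>set us \<subseteq> S; set vs \<subseteq> S\<rbrakk> \<Longrightarrow> wp (us @ vs) = wp us \<otimes> wp vs"
  by (induction us) (auto simp: m_assoc)

text \<open>A choice made once, so that the matrix need not be carried through the lemmas.\<close>

definition mat where
  "mat = (SOME m. coxeter_matrix S m \<and>
     (\<forall>u\<in>lists S. \<forall>v\<in>lists S. wp u = wp v \<longleftrightarrow> coxeter_cong S m u v))"

lemma mat: "coxeter_matrix S mat"
  and wp_eq_iff: "\<lbrakk>set u \<subseteq> S; set v \<subseteq> S\<rbrakk> \<Longrightarrow> wp u = wp v \<longleftrightarrow> coxeter_cong S mat u v"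
proof -
  have "\<exists>m. coxeter_matrix S m \<and>
     (\<forall>u\<in>lists S. \<forall>v\<in>lists S. wp u = wp v \<longleftrightarrow> coxeter_cong S m u v)"
    using coxeter by (simp add: coxeter_system_def)
  then have *: "coxeter_matrix S mat \<and>
     (\<forall>u\<in>lists S. \<forall>v\<in>lists S. wp u = wp v \<longleftrightarrow> coxeter_cong S mat u v)"
    unfolding mat_def by (rule someI_ex)
  then show "coxeter_matrix S mat" by blast
  show "\<lbrakk>set u \<subseteq> S; set v \<subseteq> S\<rbrakk> \<Longrightarrow> wp u = wp v \<longleftrightarrow> coxeter_cong S mat u v"
    using * by (simp add: in_lists_conv_set subset_iff)
qed

lemma S_square [simp]: "s \<in> S \<Longrightarrow> s \<otimes> s = \<one>"
proof -
  assume s: "s \<in> S"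
  have "mat s s = 1" using mat s by (auto simp: coxeter_matrix_def)
  then have "relator mat s s = [s, s]" by (simp add: relator_def)
  then have "coxeter_cong S mat [s, s] []"
    using coxeter_cong.relator[of "[]" S "[]" s s mat] s by simp
  then show ?thesis using wp_eq_iff[of "[s, s]" "[]"] s by simp
qed

lemma S_inv [simp]: "s \<in> S \<Longrightarrow> inv s = s"
  by (simp add: inv_equality)

lemma S_cancel [simp]:
  assumes "s \<in> S" "x \<in> carrier G"
  shows "s \<otimes> (s \<otimes> x) = x" "x \<otimes> s \<otimes> s = x"
  using assms by (simp_all add: m_assoc[symmetric]) (simp add: m_assoc)

lemma wp_rev: "set ws \<subseteq> S \<Longrightarrow> wp (rev ws) = inv (wp ws)"
  by (induction ws) (auto simp: inv_mult_group)

lemma generate_words: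
  assumes "I \<subseteq> S"
  shows "generate G I = {wp ws | ws. set ws \<subseteq> I}"
proof (intro subset_antisym subsetI)
  fix x assume "x \<in> generate G I"
  then show "x \<in> {wp ws | ws. set ws \<subseteq> I}"
  proof (induction rule: generate.induct)
    case one
    show ?case by (intro CollectI exI[of _ "[]"]) simp
  next
    case (incl h)
    then show ?case using assms by (intro CollectI exI[of _ "[h]"]) auto
  next
    case (inv h)
    then have "h \<in> S" using assms by auto
    then show ?case using inv by (intro CollectI exI[of _ "[h]"]) auto
  next
    case (eng h1 h2)
    then obtain u v where "h1 = wp u" "h2 = wp v" "set u \<subseteq> I" "set v \<subseteq> I" by auto
    then show ?case using assms by (intro CollectI exI[of _ "u @ v"]) auto
  qed
next
  fix x assume "x \<in> {wp ws | ws. set ws \<subseteq> I}"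
  then obtain ws where "x = wp ws" "set ws \<subseteq> I" by auto
  then show "x \<in> generate G I"
    by (induction ws arbitrary: x) (auto intro: generate.intros)
qed

lemma word_ex:
  assumes "w \<in> carrier G"
  shows "\<exists>ws. set ws \<subseteq> S \<and> wp ws = w"
  proof -
  have "generate G S = carrier G" using coxeter by (simp add: coxeter_system_def)
  with assms generate_words[OF subset_refl] show ?thesis by auto
qed

lemma len_le: "set ws \<subseteq> S \<Longrightarrow> len (wp ws) \<le> length ws"
  unfolding coxeter_length_def by (rule Least_le) auto

lemma reduced_word:
  assumes "w \<in> carrier G"
  shows "\<exists>ws. set ws \<subseteq> S \<and> wp ws = w \<and> length ws = len w"
proof -
  obtain vs where "set vs \<subseteq> S" "wp vs = w" using word_ex[OF assms] by blast
  then have "\<exists>n. \<exists>ws\<in>lists S. length ws = n \<and> wp ws = w" by auto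
  then have "\<exists>ws\<in>lists S. length ws = len w \<and> wp ws = w"
    unfolding coxeter_length_def by (rule LeastI_ex)
  then show ?thesis by auto
qed

lemma len_one [simp]: "len \<one> = 0"
  using len_le[of "[]"] by simp

lemma len_mult_le:
  assumes "x \<in> carrier G" "y \<in> carrier G"
  shows "len (x \<otimes> y) \<le> len x + len y"
proof -
  obtain u where "set u \<subseteq> S" "wp u = x" "length u = len x" using reduced_word[OF assms(1)] by blast
  moreover obtain v where "set v \<subseteq> S" "wp v = y" "length v = len y"
    using reduced_word[OF assms(2)] by blast
  ultimately show ?thesis using len_le[of "u @ v"] by simp
qed

lemma len_inv [simp]:
  assumes "x \<in> carrier G" shows "len (inv x) = len x"
proof -
  have "len (inv y) \<le> len y" if "y \<in> carrier G" for y
  proof -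
    obtain u where u: "set u \<subseteq> S" "wp u = y" "length u = len y" using reduced_word[OF \<open>y \<in> carrier G\<close>] by blast
    then show ?thesis using len_le[of "rev u"] wp_rev[OF u(1)] by simp
  qed
  from this[of x] this[of "inv x"] assms show ?thesis by simp
qed

lemma len_S_le: "s \<in> S \<Longrightarrow> len s \<le> 1"
  using len_le[of "[s]"] by simp

text \<open>All relators have even length, so the parity of a word depends on its product
  only. In particular multiplication by a generator always changes the length.\<close>

lemma parity_length:
  assumes "set u \<subseteq> S" "set v \<subseteq> S" "wp u = wp v"
  shows "even (length u) \<longleftrightarrow> even (length v)"
proof -
  have relator_length: "length (relator mat s t) = 2 * mat s t" for s t
    by (simp add: relator_def length_concat sum_list_replicate)
  have "coxeter_cong S mat u v" using wp_eq_iff assms by blast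
  then show ?thesis
    by (induction rule: coxeter_cong.induct) (auto simp: relator_length)
qed

lemma parity_len: "set u \<subseteq> S \<Longrightarrow> even (len (wp u)) \<longleftrightarrow> even (length u)"
  by (metis parity_length reduced_word wp_closed)

lemma len_mult_S:
  assumes "s \<in> S" "w \<in> carrier G"
  shows "len (s \<otimes> w) = len w + 1 \<or> len w = len (s \<otimes> w) + 1"
    and "len (w \<otimes> s) = len w + 1 \<or> len w = len (w \<otimes> s) + 1"
proof -
  have left: "len (s \<otimes> w) = len w + 1 \<or> len w = len (s \<otimes> w) + 1"
    if w: "w \<in> carrier G" for w
  proof -
    obtain u where u: "set u \<subseteq> S" "wp u = w" using word_ex w by blast
    have "even (len (s \<otimes> w)) \<noteq> even (len w)"
      using parity_len[of "s # u"] parity_len[of u] u assms by simp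
    moreover have "len (s \<otimes> w) \<le> 1 + len w"
      using len_mult_le[of s w] len_S_le[of s] assms w by simp
    moreover have "len (s \<otimes> (s \<otimes> w)) \<le> 1 + len (s \<otimes> w)"
      using len_mult_le[of s "s \<otimes> w"] len_S_le[of s] assms w by (simp del: S_cancel)
    ultimately show ?thesis using assms w by (cases "len w" "len (s \<otimes> w)" rule: linorder_cases)
      (auto simp: not_less_eq_eq le_Suc_eq)
  qed
  show "len (s \<otimes> w) = len w + 1 \<or> len w = len (s \<otimes> w) + 1" using left assms by blast
  have "len (w \<otimes> s) = len (s \<otimes> inv w)"
    using len_inv[of "w \<otimes> s"] assms by (simp add: inv_mult_group)
  then show "len (w \<otimes> s) = len w + 1 \<or> len w = len (w \<otimes> s) + 1"
    using left[of "inv w"] assms by simp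
qed

section \<open>The exchange condition\<close>

text \<open>For a word \<open>s\<^sub>1 \<dots> s\<^sub>k\<close> these are the reflections
  \<open>s\<^sub>1 \<dots> s\<^sub>i \<dots> s\<^sub>1\<close>, listed with repetitions; multiplying the product of the
  word from the left by the \<open>i\<close>-th of them deletes the letter \<open>s\<^sub>i\<close>.\<close>

primrec word_refls where
  "word_refls [] = []"
| "word_refls (s # ws) = s # map (\<lambda>t. s \<otimes> t \<otimes> s) (word_refls ws)"

lemma word_refls_closed: "set ws \<subseteq> S \<Longrightarrow> set (word_refls ws) \<subseteq> carrier G"
  by (induction ws) auto

lemma word_refls_append:
  assumes "set u \<subseteq> S" "set v \<subseteq> S"
  shows "word_refls (u @ v) = word_refls u @ map (\<lambda>t. wp u \<otimes> t \<otimes> inv (wp u)) (word_refls v)"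
  using assms(1)
proof (induction u)
  case Nil
  have "map (\<lambda>t. \<one> \<otimes> t \<otimes> inv \<one>) (word_refls v) = word_refls v"
    using word_refls_closed[OF assms(2)] by (intro map_idI) auto
  then show ?case by simp
next
  case (Cons s u)
  have "s \<otimes> (wp u \<otimes> t \<otimes> inv (wp u)) \<otimes> s = s \<otimes> wp u \<otimes> t \<otimes> inv (s \<otimes> wp u)"
    if "t \<in> carrier G" for t
    using Cons.prems that by (simp add: inv_mult_group m_assoc)
  then show ?case using Cons word_refls_closed[OF assms(2)] by (auto intro!: map_cong)
qed

lemma word_refls_alternating:
  assumes "s \<in> S" "t \<in> S"
  shows "word_refls (concat (replicate n [s, t])) = map (\<lambda>j. (s \<otimes> t) [^] j \<otimes> s) [0..<2 * n]"
proof (induction n)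
  case (Suc n)
  have upt: "[0..<2 * Suc n] = 0 # 1 # map (\<lambda>j. j + 2) [0..<2 * n]"
    using map_add_upt[of 2 "2 * n"] by (simp add: upt_conv_Cons numeral_2_eq_2 del: upt_Suc)
  have "s \<otimes> (t \<otimes> ((s \<otimes> t) [^] j \<otimes> s) \<otimes> t) \<otimes> s = (s \<otimes> t) [^] (j + 2) \<otimes> s" for j :: nat
  proof -
    have "(s \<otimes> t) [^] (1 + j + 1) = (s \<otimes> t) \<otimes> (s \<otimes> t) [^] j \<otimes> (s \<otimes> t)"
      using assms nat_pow_mult[of "s \<otimes> t" 1 j] by (simp del: nat_pow_mult)
    then have "(s \<otimes> t) [^] (j + 2) = (s \<otimes> t) \<otimes> (s \<otimes> t) [^] j \<otimes> (s \<otimes> t)" by (simp add: numeral_2_eq_2)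
    then show ?thesis using assms by (simp only:) (simp add: m_assoc)
  qed
  with Suc assms show ?case unfolding upt by (simp add: m_assoc del: upt_Suc mult_Suc_right)
qed simp

lemma relator_trivial:
  assumes "s \<in> S" "t \<in> S"
  shows "set (relator mat s t) \<subseteq> S" "wp (relator mat s t) = \<one>" "(s \<otimes> t) [^] mat s t = \<one>"
proof -
  show sub: "set (relator mat s t) \<subseteq> S" using assms by (auto simp: relator_def)
  show one: "wp (relator mat s t) = \<one>"
    using wp_eq_iff[OF sub, of "[]"] coxeter_cong.relator[of "[]" S "[]" s t mat] assms(1,2) by simp
  have "wp (concat (replicate n [s, t])) = (s \<otimes> t) [^] n" for n
  proof (induction n)
    case (Suc n)
    have "(s \<otimes> t) [^] Suc n = s \<otimes> t \<otimes> (s \<otimes> t) [^] n"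
      using nat_pow_Suc2[of "s \<otimes> t" n] assms by simp
    then show ?case using Suc assms by (simp add: m_assoc)
  qed simp
  then show "(s \<otimes> t) [^] mat s t = \<one>" using one by (simp add: relator_def)
qed

text \<open>The reflections of the word \<open>(st)\<^sup>m\<close> are \<open>(st)\<^sup>j s\<close> for
  \<open>j < 2m\<close>, and \<open>(st)\<^sup>m = 1\<close> makes this list periodic with period \<open>m\<close>.\<close>

lemma word_refls_relator:
  assumes "s \<in> S" "t \<in> S"
  shows "\<exists>L. word_refls (relator mat s t) = L @ L"
proof -
  let ?f = "\<lambda>j. (s \<otimes> t) [^] j \<otimes> s"
  have one: "(s \<otimes> t) [^] mat s t = \<one>" by (rule relator_trivial(3)[OF assms])
  have "?f (j + mat s t) = ?f j" for j
    using one assms by (simp add: nat_pow_mult[symmetric])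
  then have "map ?f (map (\<lambda>j. j + mat s t) [0..<mat s t]) = map ?f [0..<mat s t]" by simp
  moreover have "[0..<2 * mat s t] = [0..<mat s t] @ map (\<lambda>j. j + mat s t) [0..<mat s t]"
    using upt_add_eq_append[of 0 "mat s t" "mat s t"] by (simp add: map_add_upt mult_2)
  ultimately show ?thesis
    using word_refls_alternating[OF assms, of "mat s t"]
    by (intro exI[of _ "map ?f [0..<mat s t]"]) (simp add: relator_def)
qed

text \<open>Inserting a relator inserts a list of the form \<open>L @ L\<close>, conjugated by the product
  of the letters before it, and leaves the remaining entries alone. Hence the parity with which a
  reflection occurs is an invariant of the group element. This is the classical route from the
  presentation to the exchange condition.\<close>

lemma word_refls_parity:
  assumes "set u \<subseteq> S" "set v \<subseteq> S" "wp u = wp v"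
  shows "even (count_list (word_refls u) t) \<longleftrightarrow> even (count_list (word_refls v) t)"
proof -
  have "coxeter_cong S mat u v \<Longrightarrow> even (count_list (word_refls u) t) \<longleftrightarrow> even (count_list (word_refls v) t)"
  proof (induction rule: coxeter_cong.induct)
    case (relator u v a b)
    note r = relator_trivial[OF \<open>a \<in> S\<close> \<open>b \<in> S\<close>]
    have uv: "set u \<subseteq> S" "set v \<subseteq> S" using relator by auto
    obtain L where L: "word_refls (relator mat a b) = L @ L"
      using word_refls_relator[OF \<open>a \<in> S\<close> \<open>b \<in> S\<close>] by blast
    have "map (\<lambda>t. \<one> \<otimes> t \<otimes> inv \<one>) (word_refls v) = word_refls v"
      using word_refls_closed[OF uv(2)] by (intro map_idI) auto
    then have "word_refls (relator mat a b @ v) = L @ L @ word_refls v"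
      using word_refls_append[OF r(1) uv(2)] r(2) L by simp
    then show ?case
      using word_refls_append[OF uv(1), of "relator mat a b @ v"] word_refls_append[OF uv]
        r(1) uv by auto
  qed auto
  then show ?thesis using wp_eq_iff assms by blast
qed

lemma word_refls_delete:
  assumes "set ws \<subseteq> S" "t \<in> set (word_refls ws)"
  shows "\<exists>vs. subseq vs ws \<and> length ws = length vs + 1 \<and> t \<otimes> wp ws = wp vs"
  using assms
proof (induction ws arbitrary: t)
  case (Cons s ws)
  show ?case
  proof (cases "t = s")
    case True
    then show ?thesis using Cons.prems by (intro exI[of _ ws]) auto
  next
    case False
    then obtain r where r: "r \<in> set (word_refls ws)" "t = s \<otimes> r \<otimes> s" using Cons.prems by auto
    then obtain vs where vs: "subseq vs ws" "length ws = length vs + 1" "r \<otimes> wp ws = wp vs"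
      using Cons by auto
    have "r \<in> carrier G" using r word_refls_closed[of ws] Cons.prems by auto
    then have "t \<otimes> wp (s # ws) = s \<otimes> (r \<otimes> wp ws)"
      using r(2) Cons.prems by (simp add: m_assoc)
    then show ?thesis using vs by (intro exI[of _ "s # vs"]) auto
  qed
qed simp

lemma subseq_S: "subseq vs ws \<Longrightarrow> set ws \<subseteq> I \<Longrightarrow> set vs \<subseteq> I"
  by (auto dest: list_emb_set)

text \<open>If \<open>s\<close> shortens \<open>w\<close>, then \<open>w\<close> has a reduced word starting with
  \<open>s\<close>, in which the reflection \<open>s\<close> occurs exactly once. By parity it occurs in
  every word for \<open>w\<close>, and deleting the corresponding letter multiplies by \<open>s\<close>.\<close>

lemma exchange_left:
  assumes ws: "set ws \<subseteq> S" and s: "s \<in> S" and less: "len (s \<otimes> wp ws) < len (wp ws)"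
  shows "\<exists>vs. subseq vs ws \<and> length ws = length vs + 1 \<and> s \<otimes> wp ws = wp vs"
proof -
  obtain vs where vs: "set vs \<subseteq> S" "wp vs = s \<otimes> wp ws" "length vs = len (s \<otimes> wp ws)"
    using reduced_word[of "s \<otimes> wp ws"] ws s by auto
  have eq: "wp (s # vs) = wp ws" using vs ws s by simp
  \<comment> \<open>A second occurrence of \<open>s\<close> in the reflections of \<open>s # vs\<close> would allow a letter of \<open>vs\<close> to be deleted.\<close>
  have "s \<notin> set (map (\<lambda>t. s \<otimes> t \<otimes> s) (word_refls vs))"
  proof
    assume "s \<in> set (map (\<lambda>t. s \<otimes> t \<otimes> s) (word_refls vs))"
    then obtain r where r: "r \<in> set (word_refls vs)" "s = s \<otimes> r \<otimes> s" by auto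
    have rc: "r \<in> carrier G" using r word_refls_closed vs by blast
    have "s \<otimes> s \<otimes> s = s \<otimes> (s \<otimes> r \<otimes> s) \<otimes> s" using r(2) by simp
    then have "r = s" using rc s by (simp add: m_assoc)
    then obtain us where us: "subseq us vs" "length vs = length us + 1" "s \<otimes> wp vs = wp us"
      using word_refls_delete[OF vs(1) r(1)] by auto
    then have "len (wp ws) \<le> length us" using eq len_le[of us] subseq_S[OF us(1) vs(1)] by simp
    then show False using less vs us by simp
  qed
  then have "odd (count_list (word_refls (s # vs)) s)"
    by (simp add: count_list_0_iff)
  then have "odd (count_list (word_refls ws) s)"
    using word_refls_parity[of "s # vs" ws s] vs ws s eq by auto
  then have "s \<in> set (word_refls ws)" by (metis count_notin even_zero)
  then show ?thesis using word_refls_delete ws by blast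
qed

lemma exchange_right:
  assumes ws: "set ws \<subseteq> S" and s: "s \<in> S" and less: "len (wp ws \<otimes> s) < len (wp ws)"
  shows "\<exists>vs. subseq vs ws \<and> length ws = length vs + 1 \<and> wp ws \<otimes> s = wp vs"
proof -
  have eq: "s \<otimes> wp (rev ws) = inv (wp ws \<otimes> s)" using ws s by (simp add: wp_rev inv_mult_group)
  then have "len (s \<otimes> wp (rev ws)) < len (wp (rev ws))" using less ws s by (simp add: wp_rev)
  then obtain vs where vs: "subseq vs (rev ws)" "length ws = length vs + 1" "s \<otimes> wp (rev ws) = wp vs"
    using exchange_left[of "rev ws" s] ws s by auto
  have "set vs \<subseteq> S" using subseq_S[OF vs(1)] ws by simp
  then have "wp ws \<otimes> s = wp (rev vs)" using vs(3) eq ws s by (simp add: wp_rev)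
  moreover have "subseq (rev vs) ws" using vs(1) subseq_rev by fastforce
  ultimately show ?thesis using vs(2) by auto
qed

text \<open>The deletion condition in the form in which it is used below: the deleted letters are not
  located, but a subword of a concatenation splits along the concatenation, and subwords of words
  in \<open>I\<close> are words in \<open>I\<close>.\<close>

lemma reduced_subword:
  assumes "set ws \<subseteq> S"
  shows "\<exists>vs. subseq vs ws \<and> wp vs = wp ws \<and> length vs = len (wp ws)"
  using assms
proof (induction ws)
  case (Cons s ws)
  then obtain vs where vs: "subseq vs ws" "wp vs = wp ws" "length vs = len (wp ws)" by auto
  have vsS: "set vs \<subseteq> S" using subseq_S[OF vs(1)] Cons.prems by simp
  have s: "s \<in> S" and c: "wp ws \<in> carrier G" using Cons.prems by auto
  from len_mult_S(1)[OF s c] show ?case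
  proof
    assume "len (s \<otimes> wp ws) = len (wp ws) + 1"
    then show ?thesis using vs by (intro exI[of _ "s # vs"]) auto
  next
    assume *: "len (wp ws) = len (s \<otimes> wp ws) + 1"
    then obtain us where "subseq us vs" "length vs = length us + 1" "s \<otimes> wp vs = wp us"
      using exchange_left[OF vsS s] vs by auto
    then show ?thesis using * vs by (intro exI[of _ us]) (auto intro: subseq_order.trans)
  qed
qed simp

section \<open>Parabolic subgroups\<close>

lemma left_descents_inv:
  assumes "x \<in> carrier G" shows "left_descents G S (inv x) = right_descents G S x"
proof -
  have "len (s \<otimes> inv x) = len (x \<otimes> s)" if "s \<in> S" for s
    using len_inv[of "x \<otimes> s"] that assms by (simp add: inv_mult_group)
  then show ?thesis using assms unfolding left_descents_def right_descents_def by auto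
qed

lemma parabolic_closed [simp]: "J \<subseteq> S \<Longrightarrow> u \<in> generate G J \<Longrightarrow> u \<in> carrier G"
  using generate_in_carrier[of J] S_subset by blast

lemma parabolic_reduced_word:
  assumes "I \<subseteq> S" "u \<in> generate G I"
  shows "\<exists>b. set b \<subseteq> I \<and> wp b = u \<and> length b = len u"
proof -
  obtain c where c: "set c \<subseteq> I" "wp c = u" using assms by (auto simp: generate_words)
  then obtain b where "subseq b c" "wp b = wp c" "length b = len (wp c)"
    using reduced_subword[of c] assms(1) by blast
  then show ?thesis using c subseq_S[of b c I] by blast
qed

lemma wp_parabolic: "I \<subseteq> S \<Longrightarrow> set b \<subseteq> I \<Longrightarrow> wp b \<in> generate G I"
  using generate_words[of I] by auto

lemma parabolic_mult: "I \<subseteq> S \<Longrightarrow> u \<in> generate G I \<Longrightarrow> v \<in> generate G I \<Longrightarrow> u \<otimes> v \<in> generate G I"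
  by (rule generate.eng)

lemma parabolic_S: "s \<in> I \<Longrightarrow> s \<in> generate G I"
  by (rule generate.incl)

lemma parabolic_inv: "I \<subseteq> S \<Longrightarrow> u \<in> generate G I \<Longrightarrow> inv u \<in> generate G I"
  using generate_m_inv_closed[of I] S_subset by blast

lemma len_S: "s \<in> S \<Longrightarrow> len s = 1"
  using len_mult_S(1)[of s \<one>] by simp

lemma len_one_parabolic:
  assumes "I \<subseteq> S" "u \<in> generate G I" "len u = 1"
  shows "u \<in> I"
proof -
  obtain b where b: "set b \<subseteq> I" "wp b = u" "length b = 1"
    using parabolic_reduced_word[OF assms(1,2)] assms(3) by auto
  then obtain s where "b = [s]" by (auto simp: length_Suc_conv)
  then show ?thesis using b assms(1) by auto
qed

section \<open>Double cosets and their shortest elements\<close>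

abbreviation dcoset where
  "dcoset J w I \<equiv> generate G J <#> {w} <#> generate G I"

lemma mem_dcoset:
  "y \<in> dcoset J w I \<longleftrightarrow> (\<exists>a\<in>generate G J. \<exists>b\<in>generate G I. y = a \<otimes> w \<otimes> b)"
  by (auto simp: set_mult_def)

lemma dcoset_refl: "w \<in> carrier G \<Longrightarrow> w \<in> dcoset J w I"
  unfolding mem_dcoset by (intro bexI[of _ \<one>]) (auto intro: generate.one)

lemma dcoset_eq:
  assumes "J \<subseteq> S" "I \<subseteq> S" "w \<in> carrier G" "y \<in> dcoset J w I"
  shows "dcoset J y I = dcoset J w I"
proof -
  have sub: "dcoset J y I \<subseteq> dcoset J w I" if wy: "w \<in> carrier G" "y \<in> dcoset J w I" for w y
  proof
    fix z assume "z \<in> dcoset J y I"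
    then obtain a b where ab: "a \<in> generate G J" "b \<in> generate G I" "z = a \<otimes> y \<otimes> b"
      by (auto simp: mem_dcoset)
    obtain c d where cd: "c \<in> generate G J" "d \<in> generate G I" "y = c \<otimes> w \<otimes> d"
      using wy(2) unfolding mem_dcoset by blast
    have "a \<in> carrier G" "b \<in> carrier G" "c \<in> carrier G" "d \<in> carrier G"
      using ab cd assms by auto
    then have "z = (a \<otimes> c) \<otimes> w \<otimes> (d \<otimes> b)" using ab cd wy(1) by (simp add: m_assoc)
    then show "z \<in> dcoset J w I"
      using ab cd assms by (auto simp: mem_dcoset intro!: bexI parabolic_mult)
  qed
  obtain c d where cd: "c \<in> generate G J" "d \<in> generate G I" "y = c \<otimes> w \<otimes> d"
    using assms(4) unfolding mem_dcoset by blast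
  have c: "c \<in> carrier G" "d \<in> carrier G" using cd assms by auto
  then have "w = inv c \<otimes> y \<otimes> inv d" using cd assms by (simp add: m_assoc inv_solve_left)
  then have "w \<in> dcoset J y I" using cd assms by (auto simp: mem_dcoset intro!: bexI parabolic_inv)
  moreover have "y \<in> carrier G" using cd c assms by simp
  ultimately show ?thesis using sub assms by blast
qed

lemma dcoset_closed: "J \<subseteq> S \<Longrightarrow> I \<subseteq> S \<Longrightarrow> w \<in> carrier G \<Longrightarrow> dcoset J w I \<subseteq> carrier G"
  by (auto simp: mem_dcoset)

lemma double_cosets_eq_dcoset:
  assumes "J \<subseteq> S" "I \<subseteq> S" "p \<in> double_cosets G J I" "w \<in> p"
  shows "p = dcoset J w I" "w \<in> carrier G"
  using assms dcoset_eq[OF assms(1,2)] dcoset_closed[OF assms(1,2)]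
  unfolding double_cosets_def by blast+

lemma dcoset_in_double_cosets: "w \<in> carrier G \<Longrightarrow> dcoset J w I \<in> double_cosets G J I"
  unfolding double_cosets_def by blast

lemma double_cosets_nonempty: "p \<in> double_cosets G J I \<Longrightarrow> \<exists>w. w \<in> p"
  unfolding double_cosets_def using dcoset_refl by blast

lemma double_cosets_mult:
  assumes "J \<subseteq> S" "I \<subseteq> S" "p \<in> double_cosets G J I" "w \<in> p"
  shows "a \<in> generate G J \<Longrightarrow> a \<otimes> w \<in> p" "b \<in> generate G I \<Longrightarrow> w \<otimes> b \<in> p"
proof -
  note p = double_cosets_eq_dcoset[OF assms]
  show "a \<otimes> w \<in> p" if a: "a \<in> generate G J"
    unfolding p(1) mem_dcoset using a p(2) assms
    by (intro bexI[of _ a] bexI[of _ \<one>]) (auto intro: generate.one)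
  show "w \<otimes> b \<in> p" if b: "b \<in> generate G I"
    unfolding p(1) mem_dcoset using b p(2) assms
    by (intro bexI[of _ b] bexI[of _ \<one>]) (auto intro: generate.one)
qed

text \<open>A word for an element of \<open>W\<^sub>J x W\<^sub>I\<close> can be taken of the form \<open>a e b\<close>
  with \<open>a\<close> in \<open>J\<close>, \<open>e\<close> a reduced word of \<open>x\<close> and \<open>b\<close> in \<open>I\<close>. Reducing
  it cannot delete letters of \<open>e\<close>, since that would give a shorter element of the double
  coset.\<close>

lemma min_length_factorization:
  assumes J: "J \<subseteq> S" and I: "I \<subseteq> S" and p: "p \<in> double_cosets G J I"
    and x: "x \<in> p" "\<And>y. y \<in> p \<Longrightarrow> len x \<le> len y" and y: "y \<in> p"
  shows "\<exists>a b. set a \<subseteq> J \<and> set b \<subseteq> I \<and> y = wp a \<otimes> x \<otimes> wp b \<and>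
    len y = length a + len x + length b"
proof -
  note p = double_cosets_eq_dcoset[OF J I p x(1)]
  obtain c d where cd: "set c \<subseteq> J" "set d \<subseteq> I" "y = wp c \<otimes> x \<otimes> wp d"
    using y generate_words J I unfolding p(1) mem_dcoset by auto
  obtain e where e: "set e \<subseteq> S" "wp e = x" "length e = len x" using reduced_word p by blast
  have S: "set c \<subseteq> S" "set d \<subseteq> S" using cd J I by auto
  have ced: "set ((c @ e) @ d) \<subseteq> S" "wp ((c @ e) @ d) = y"
    using cd e S p(2) by (simp_all add: m_assoc)
  obtain v where v: "subseq v ((c @ e) @ d)" "wp v = y" "length v = len y"
    using reduced_subword[OF ced(1)] unfolding ced(2) by blast
  obtain u b where ub: "v = u @ b" "subseq u (c @ e)" "subseq b d"
    using v(1) subseq_append_iff[of v "c @ e" d] by blast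
  obtain a e' where ae: "u = a @ e'" "subseq a c" "subseq e' e"
    using ub(2) by (auto simp: subseq_append_iff)
  note aeb = ub(1)[unfolded ae(1)] ae(2,3) ub(3)
  have sets: "set a \<subseteq> J" "set b \<subseteq> I" "set e' \<subseteq> S" "set a \<subseteq> S" "set b \<subseteq> S"
    using subseq_S[OF aeb(2)] subseq_S[OF aeb(3)] subseq_S[OF aeb(4)] cd e S by simp_all
  have y': "y = wp a \<otimes> wp e' \<otimes> wp b" using v(2) aeb(1) sets by (simp add: m_assoc)
  then have "wp e' = inv (wp a) \<otimes> y \<otimes> inv (wp b)"
    using sets by (simp add: m_assoc inv_solve_left)
  then have "wp e' \<in> dcoset J y I"
    using sets wp_parabolic parabolic_inv J I unfolding mem_dcoset by blast
  then have "wp e' \<in> p" using dcoset_eq[OF J I p(2)] y p(1) by blast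
  then have "length e \<le> len (wp e')" using x(2) e by simp
  also have "\<dots> \<le> length e'" by (rule len_le) (fact sets)
  finally have "e' = e" using aeb(3) by (meson list_emb_length subseq_same_length order_antisym)
  then show ?thesis using y' e sets v aeb by (intro exI[of _ a] exI[of _ b]) auto
qed

lemma min_length_exists:
  assumes "p \<in> double_cosets G J I"
  shows "\<exists>x\<in>p. \<forall>y\<in>p. len x \<le> len y"
proof -
  obtain w where "w \<in> p" using double_cosets_nonempty assms by blast
  then have "\<exists>x. is_arg_min len (\<lambda>x. x \<in> p) x"
    using ex_has_least_nat[of "\<lambda>x. x \<in> p" w len] by (auto simp: is_arg_min_linorder)
  then show ?thesis by (auto simp: is_arg_min_linorder)
qed

text \<open>An element without descents towards \<open>J\<close> and \<open>I\<close> is a shortest one: in its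
  factorization through a shortest element the outer words have to be empty.\<close>

lemma no_descents_factorization:
  assumes J: "J \<subseteq> S" and I: "I \<subseteq> S" and p: "p \<in> double_cosets G J I"
    and x: "x \<in> p" "J \<inter> left_descents G S x = {}" "I \<inter> right_descents G S x = {}" and y: "y \<in> p"
  shows "\<exists>a b. set a \<subseteq> J \<and> set b \<subseteq> I \<and> y = wp a \<otimes> x \<otimes> wp b \<and>
    len y = length a + len x + length b"
proof -
  obtain z where z: "z \<in> p" "\<And>y. y \<in> p \<Longrightarrow> len z \<le> len y" using min_length_exists[OF p] by blast
  have zc: "z \<in> carrier G" using double_cosets_eq_dcoset(2)[OF J I p z(1)] .
  obtain a b where ab: "set a \<subseteq> J" "set b \<subseteq> I" "x = wp a \<otimes> z \<otimes> wp b"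
    "len x = length a + len z + length b"
    using min_length_factorization[OF J I p z x(1)] by blast
  have abS: "set a \<subseteq> S" "set b \<subseteq> S" using ab J I by auto
  have "a = []"
  proof (rule ccontr)
    assume "a \<noteq> []"
    then obtain s c where a: "a = s # c" by (cases a) auto
    have s: "s \<in> S" "s \<in> J" using a ab J by auto
    have cS: "set c \<subseteq> S" using a abS by auto
    have "s \<otimes> x = wp c \<otimes> z \<otimes> wp b" using ab a s cS abS zc by (simp add: m_assoc)
    then have "len (s \<otimes> x) \<le> length c + len z + length b"
      using len_mult_le[of "wp c \<otimes> z" "wp b"] len_mult_le[of "wp c" z] len_le[of c] len_le[of b] cS abS zc
      by simp
    then show False using ab a s x(2) unfolding left_descents_def by auto
  qed
  have "b = []"
  proof (rule ccontr)
    assume "b \<noteq> []"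
    then obtain s c where b: "b = c @ [s]" by (metis rev_exhaust)
    have s: "s \<in> S" "s \<in> I" using b ab I by auto
    have cS: "set c \<subseteq> S" using b abS by auto
    have "x \<otimes> s = wp a \<otimes> z \<otimes> wp c" using ab b s cS abS zc by (simp add: m_assoc)
    then have "len (x \<otimes> s) \<le> length a + len z + length c"
      using len_mult_le[of "wp a \<otimes> z" "wp c"] len_mult_le[of "wp a" z] len_le[of c] len_le[of a] cS abS zc
      by simp
    then show False using ab b s x(3) unfolding right_descents_def by auto
  qed
  have "x = z" using ab \<open>a = []\<close> \<open>b = []\<close> zc by simp
  then show ?thesis using min_length_factorization[OF J I p z y] by simp
qed

lemma min_length_no_descents:
  assumes J: "J \<subseteq> S" and I: "I \<subseteq> S" and p: "p \<in> double_cosets G J I"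
    and x: "x \<in> p" "\<And>y. y \<in> p \<Longrightarrow> len x \<le> len y"
  shows "J \<inter> left_descents G S x = {}" "I \<inter> right_descents G S x = {}"
proof -
  have "len x \<le> len (s \<otimes> x)" if "s \<in> J" for s
    using x(2) double_cosets_mult(1)[OF J I p x(1) parabolic_S[OF that]] .
  then show "J \<inter> left_descents G S x = {}" by (fastforce simp: left_descents_def not_less)
  have "len x \<le> len (x \<otimes> s)" if "s \<in> I" for s
    using x(2) double_cosets_mult(2)[OF J I p x(1) parabolic_S[OF that]] .
  then show "I \<inter> right_descents G S x = {}" by (fastforce simp: right_descents_def not_less)
qed

lemma no_descents_unique:
  assumes J: "J \<subseteq> S" and I: "I \<subseteq> S" and p: "p \<in> double_cosets G J I"
    and x: "x \<in> p" "J \<inter> left_descents G S x = {}" "I \<inter> right_descents G S x = {}"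
    and y: "y \<in> p" "J \<inter> left_descents G S y = {}" "I \<inter> right_descents G S y = {}"
  shows "y = x"
proof -
  have xc: "x \<in> carrier G" using double_cosets_eq_dcoset(2)[OF J I p x(1)] .
  obtain a b where 1: "y = wp a \<otimes> x \<otimes> wp b" "len y = length a + len x + length b"
    using no_descents_factorization[OF J I p x y(1)] by blast
  obtain c d :: "'a list" where 2: "len x = length c + len y + length d"
    using no_descents_factorization[OF J I p y x(1)] by blast
  have "a = []" "b = []" using 1 2 by auto
  then show ?thesis using 1 xc by simp
qed

lemma len_mult_right:
  assumes I: "I \<subseteq> S" and x: "x \<in> carrier G" "I \<inter> right_descents G S x = {}"
    and u: "u \<in> generate G I"
  shows "len (x \<otimes> u) = len x + len u"
proof -
  \<comment> \<open>A one-sided coset is a double coset for the empty set on the other side.\<close>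
  have p: "dcoset {} x I \<in> double_cosets G {} I" using x(1) by (rule dcoset_in_double_cosets)
  have xp: "x \<in> dcoset {} x I" using x by (intro dcoset_refl)
  have "x \<otimes> u \<in> dcoset {} x I" using double_cosets_mult(2)[OF _ I p xp u] by simp
  then have "\<exists>b. set b \<subseteq> I \<and> x \<otimes> u = x \<otimes> wp b \<and> len (x \<otimes> u) = len x + length b"
    using no_descents_factorization[OF _ I p xp _ x(2)] x by auto
  then obtain b where b: "set b \<subseteq> I" "x \<otimes> u = x \<otimes> wp b" "len (x \<otimes> u) = len x + length b"
    by blast
  have "u \<in> carrier G" "wp b \<in> carrier G" using u b I by auto
  then have "wp b = u" using b(2) x by simp
  then have "len u \<le> length b" using len_le[of b] b I by auto
  moreover have "len (x \<otimes> u) \<le> len x + len u" using len_mult_le x \<open>u \<in> carrier G\<close> by blast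
  ultimately show ?thesis using b by simp
qed

lemma len_mult_left:
  assumes J: "J \<subseteq> S" and x: "x \<in> carrier G" "J \<inter> left_descents G S x = {}"
    and u: "u \<in> generate G J"
  shows "len (u \<otimes> x) = len u + len x"
proof -
  have uc: "u \<in> carrier G" using J u by simp
  have "J \<inter> right_descents G S (inv x) = {}"
    using left_descents_inv[of "inv x"] x by simp
  then have "len (inv x \<otimes> inv u) = len (inv x) + len (inv u)"
    using len_mult_right[OF J _ _ parabolic_inv[OF J u]] x by simp
  then show ?thesis using x uc len_inv[of "u \<otimes> x"] by (simp add: inv_mult_group)
qed

section \<open>Longest elements of double cosets\<close>

text \<open>If every element of \<open>I\<close> is a right descent of \<open>w\<close>, then every element of
  \<open>W\<^sub>I\<close> is a length-additive right factor of \<open>w\<close>. The factor grows from the right: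
  exchanging a letter of a word \<open>y b\<close> for \<open>w\<close> against \<open>s\<close> at its end must take
  the letter from \<open>y\<close>.\<close>

lemma descents_suffix:
  assumes I: "I \<subseteq> S" and w: "w \<in> carrier G" "I \<subseteq> right_descents G S w"
    and b: "set b \<subseteq> I" "length b = len (wp b)"
  shows "\<exists>y\<in>carrier G. w = y \<otimes> wp b \<and> len w = len y + length b"
  using b
proof (induction b rule: rev_induct)
  case Nil
  then show ?case using w by auto
next
  case (snoc s b)
  have s: "s \<in> S" "s \<in> I" and bI: "set b \<subseteq> I" and bS: "set b \<subseteq> S" using snoc.prems I by auto
  have less: "len (w \<otimes> s) < len w" using w s by (auto simp: right_descents_def)
  have "len (wp (b @ [s])) \<le> len (wp b) + 1"
    using len_mult_S(2)[of s "wp b"] s bS by auto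
  then have "length b = len (wp b)" using snoc.prems len_le[OF bS] by simp
  then obtain y where y: "y \<in> carrier G" "w = y \<otimes> wp b" "len w = len y + length b"
    using snoc.IH bI by blast
  obtain c where c: "set c \<subseteq> S" "wp c = y" "length c = len y" using reduced_word y by blast
  have cb: "set (c @ b) \<subseteq> S" "wp (c @ b) = w" using c bS y by auto
  then obtain v where v: "subseq v (c @ b)" "length (c @ b) = length v + 1" "w \<otimes> s = wp v"
    using exchange_right[OF cb(1) s(1)] less by auto
  obtain c' b' where cb': "v = c' @ b'" "subseq c' c" "subseq b' b"
    using v(1) by (auto simp: subseq_append_iff)
  have sets: "set c' \<subseteq> S" "set b' \<subseteq> S"
    using subseq_S[OF cb'(2)] subseq_S[OF cb'(3)] c bS by simp_all
  have ws: "w \<otimes> s = wp c' \<otimes> wp b'" using v(3) cb'(1) sets by simp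
  \<comment> \<open>Deleting a letter of \<open>b\<close> instead would shorten the reduced word \<open>b @ [s]\<close>.\<close>
  have "b' = b"
  proof (rule ccontr)
    assume "b' \<noteq> b"
    then have "length b' < length b"
      using cb'(3) by (metis list_emb_length subseq_same_length order_le_less)
    then have "length c \<le> length c'" using v(2) cb' by simp
    then have "c' = c" using cb'(2) by (meson list_emb_length subseq_same_length order_antisym)
    then have "y \<otimes> (wp b \<otimes> s) = y \<otimes> wp b'" using ws c y s bS by (simp add: m_assoc)
    then have "wp b \<otimes> s = wp b'" using y s bS sets by simp
    then have "len (wp (b @ [s])) \<le> length b'" using len_le[OF sets(2)] s bS by simp
    then show False using \<open>length b' < length b\<close> snoc.prems by simp
  qed
  have wc: "w = wp c' \<otimes> wp (b @ [s])"
  proof -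
    have "w = w \<otimes> s \<otimes> s" using w s by simp
    also have "\<dots> = wp c' \<otimes> wp b \<otimes> s" using ws \<open>b' = b\<close> by simp
    finally show ?thesis using sets s bS by (simp add: m_assoc)
  qed
  have "len w \<le> len (wp c') + length (b @ [s])"
    using len_mult_le[of "wp c'" "wp (b @ [s])"] wc snoc.prems sets s bS by simp
  moreover have "len (wp c') \<le> length c'" by (rule len_le) (fact sets)
  ultimately have "len w = len (wp c') + length (b @ [s])" using v(2) cb' \<open>b' = b\<close> y c by simp
  then show ?case using wc sets by (intro bexI[of _ "wp c'"]) auto
qed

text \<open>A predicate in \<open>y\<close>, so that its stability under multiplication by generators
  can be iterated to reach the whole double coset of \<open>w\<close>.\<close>

definition factor_of where
  "factor_of J I w y \<longleftrightarrow> y \<in> carrier G \<and> (\<exists>a b. set a \<subseteq> J \<and> set b \<subseteq> I \<and>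
     w = wp a \<otimes> y \<otimes> wp b \<and> len w = length a + len y + length b)"

lemma factor_ofI:
  assumes "J \<subseteq> S" "I \<subseteq> S" "y \<in> carrier G" "set a \<subseteq> J" "set b \<subseteq> I" "w = wp a \<otimes> y \<otimes> wp b"
    "length a + len y + length b \<le> len w"
  shows "factor_of J I w y"
proof -
  have "set a \<subseteq> S" "set b \<subseteq> S" using assms by auto
  then have "len w \<le> length a + len y + length b"
    using len_mult_le[of "wp a \<otimes> y" "wp b"] len_mult_le[of "wp a" y] len_le[of a] len_le[of b] assms
    by simp
  then show ?thesis unfolding factor_of_def using assms by (metis le_antisym)
qed

lemma factor_of_inv:
  assumes JI: "J \<subseteq> S" "I \<subseteq> S" and f: "factor_of J I w y"
  shows "factor_of I J (inv w) (inv y)"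
proof -
  obtain a b where ab: "y \<in> carrier G" "set a \<subseteq> J" "set b \<subseteq> I" "w = wp a \<otimes> y \<otimes> wp b"
    "len w = length a + len y + length b"
    using f unfolding factor_of_def by blast
  have S: "set a \<subseteq> S" "set b \<subseteq> S" using ab JI by auto
  have "inv w = wp (rev b) \<otimes> inv y \<otimes> wp (rev a)"
    using ab S by (simp add: wp_rev inv_mult_group m_assoc)
  moreover have "len (inv w) = len w" using ab S by simp
  ultimately show ?thesis
    using ab JI by (intro factor_ofI[where a = "rev b" and b = "rev a"]) auto
qed

text \<open>The possible \<open>y\<close> in \<open>w = a y b\<close> are stable under right multiplication by
  \<open>I\<close>. The interesting case is that \<open>s\<close> lengthens both \<open>y\<close> on the right and
  \<open>b\<close> on the left. As \<open>s b\<close> is a right factor of \<open>w\<close>, the generator \<open>s\<close>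
  shortens \<open>a y\<close>; since it does not shorten \<open>y\<close>, the exchange takes a letter of
  \<open>a\<close>, so that \<open>a y = a' y s\<close> with \<open>a'\<close> shorter by one.\<close>

lemma factor_of_mult_right:
  assumes J: "J \<subseteq> S" and I: "I \<subseteq> S" and w: "w \<in> carrier G" "I \<subseteq> right_descents G S w"
    and s: "s \<in> I" and f: "factor_of J I w y"
  shows "factor_of J I w (y \<otimes> s)"
proof -
  obtain a b where ab: "y \<in> carrier G" "set a \<subseteq> J" "set b \<subseteq> I" "w = wp a \<otimes> y \<otimes> wp b"
    "len w = length a + len y + length b"
    using f unfolding factor_of_def by blast
  have S: "set a \<subseteq> S" "set b \<subseteq> S" "s \<in> S" using ab J I s by auto
  have sb: "wp b = s \<otimes> (s \<otimes> wp b)" using S by simp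
  from len_mult_S(2)[OF S(3) ab(1)] show ?thesis
  proof
    assume shorter: "len y = len (y \<otimes> s) + 1"
    \<comment> \<open>Moving \<open>s\<close> from \<open>y\<close> to \<open>b\<close> keeps the total length.\<close>
    show ?thesis
      using ab S s I J shorter sb
      by (intro factor_ofI[where a = a and b = "s # b"]) (auto simp: m_assoc)
  next
    assume longer: "len (y \<otimes> s) = len y + 1"
    have yb: "len w \<le> length a + len (y \<otimes> wp b)"
      using len_mult_le[of "wp a" "y \<otimes> wp b"] len_le[of a] ab S by (simp add: m_assoc)
    have "len (y \<otimes> wp b) \<le> len y + len (wp b)" using len_mult_le ab S by simp
    then have lb: "len (wp b) = length b" using yb ab len_le[OF S(2)] by simp
    from len_mult_S(1)[OF S(3), of "wp b"] S(2) consider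
      "len (wp b) = len (s \<otimes> wp b) + 1" | "len (s \<otimes> wp b) = len (wp b) + 1" by auto
    then show ?thesis
    proof cases
      case 1
      have "s \<otimes> wp b \<in> generate G I"
        using I s ab by (intro parabolic_mult parabolic_S wp_parabolic)
      then obtain b' where b': "set b' \<subseteq> I" "wp b' = s \<otimes> wp b" "length b' = len (s \<otimes> wp b)"
        using parabolic_reduced_word[OF I] by blast
      show ?thesis
        using ab S b' 1 lb longer I J
        by (intro factor_ofI[where a = a and b = b']) (auto simp: m_assoc)
    next
      case 2
      have "length (s # b) = len (wp (s # b))" using 2 lb by simp
      then obtain z where z: "z \<in> carrier G" "w = z \<otimes> wp (s # b)" "len w = len z + length (s # b)"
        using descents_suffix[OF I w, of "s # b"] s ab by auto
      have "z \<otimes> s \<otimes> wp b = wp a \<otimes> y \<otimes> wp b" using z ab S by (simp add: m_assoc)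
      then have zs: "z \<otimes> s = wp a \<otimes> y" using z ab S by simp
      have "z = z \<otimes> s \<otimes> s" using z S by simp
      then have zeq: "z = wp a \<otimes> y \<otimes> s" using zs by simp
      obtain c where c: "set c \<subseteq> S" "wp c = y" "length c = len y" using reduced_word ab by blast
      have ac: "set (a @ c) \<subseteq> S" "wp (a @ c) = wp a \<otimes> y" using c S by auto
      have "len (wp (a @ c) \<otimes> s) = length (a @ c) - 1" "length (a @ c) \<ge> 1"
        using ac(2) zeq z(3) ab(5) c by auto
      moreover have "len (wp (a @ c)) = length (a @ c)"
      proof -
        have "len w \<le> len (wp a \<otimes> y) + length b"
          using len_mult_le[of "wp a \<otimes> y" "wp b"] lb ab S by simp
        then show ?thesis using ac len_le[OF ac(1)] ab(5) c by simp
      qed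
      ultimately have "len (wp (a @ c) \<otimes> s) < len (wp (a @ c))" by simp
      then obtain v where v: "subseq v (a @ c)" "length (a @ c) = length v + 1" "wp (a @ c) \<otimes> s = wp v"
        using exchange_right[OF ac(1) S(3)] by blast
      obtain a' c' where ac': "v = a' @ c'" "subseq a' a" "subseq c' c"
        using v(1) by (auto simp: subseq_append_iff)
      have sets: "set a' \<subseteq> J" "set a' \<subseteq> S" "set c' \<subseteq> S"
        using subseq_S[OF ac'(2)] subseq_S[OF ac'(3)] ab c S by simp_all
      have eq: "wp a \<otimes> y \<otimes> s = wp a' \<otimes> wp c'" using v(3) ac ac'(1) sets by simp
      \<comment> \<open>The deleted letter is one of \<open>a\<close>, because \<open>s\<close> lengthens \<open>y\<close>.\<close>
      have "c' = c"
      proof (rule ccontr)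
        assume "c' \<noteq> c"
        then have less: "length c' < length c"
          using ac'(3) by (metis list_emb_length subseq_same_length order_le_less)
        then have "length a \<le> length a'" using v(2) ac' by simp
        then have "a' = a" using ac'(2) by (meson list_emb_length subseq_same_length order_antisym)
        then have "y \<otimes> s = wp c'" using eq ab S sets by (simp add: m_assoc)
        then show False using len_le[OF sets(3)] less c longer by simp
      qed
      have "wp a \<otimes> y = wp a \<otimes> y \<otimes> s \<otimes> s" using ab S by simp
      then have "wp a \<otimes> y = wp a' \<otimes> y \<otimes> s" using eq \<open>c' = c\<close> c by simp
      then have "w = wp a' \<otimes> (y \<otimes> s) \<otimes> wp b" using ab S sets by (simp add: m_assoc)
      moreover have "length a = length a' + 1" using v(2) ac' \<open>c' = c\<close> by simp
      ultimately show ?thesis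
        using ab sets longer I J S by (intro factor_ofI[where a = a' and b = b]) auto
    qed
  qed
qed

lemma factor_of_mult_left:
  assumes J: "J \<subseteq> S" and I: "I \<subseteq> S" and w: "w \<in> carrier G" "J \<subseteq> left_descents G S w"
    and s: "s \<in> J" and f: "factor_of J I w y"
  shows "factor_of J I w (s \<otimes> y)"
proof -
  have y: "y \<in> carrier G" using f by (simp add: factor_of_def)
  have s': "s \<in> S" using s J by auto
  have "J \<subseteq> right_descents G S (inv w)" using w left_descents_inv[of "inv w"] by simp
  then have "factor_of I J (inv w) (inv y \<otimes> s)"
    using factor_of_mult_right[OF I J _ _ s factor_of_inv[OF J I f]] w by simp
  from factor_of_inv[OF I J this] show ?thesis using w y s' by (simp add: inv_mult_group)
qed

text \<open>Dual to the factorization through the shortest element. It shows that an element with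
  all descents in \<open>J\<close> and \<open>I\<close> is the unique longest element of its double
  coset.\<close>

lemma all_descents_factorization:
  assumes J: "J \<subseteq> S" and I: "I \<subseteq> S" and p: "p \<in> double_cosets G J I"
    and w: "w \<in> p" "J \<subseteq> left_descents G S w" "I \<subseteq> right_descents G S w" and y: "y \<in> p"
  shows "factor_of J I w y"
proof -
  note p = double_cosets_eq_dcoset[OF J I p w(1)]
  obtain c d where cd: "set c \<subseteq> J" "set d \<subseteq> I" "y = wp c \<otimes> w \<otimes> wp d"
    using y generate_words J I unfolding p(1) mem_dcoset by auto
  have S: "set c \<subseteq> S" "set d \<subseteq> S" using cd J I by auto
  have "factor_of J I w w"
    using p(2) J I by (intro factor_ofI[where a = "[]" and b = "[]"]) auto
  then have "factor_of J I w (w \<otimes> wp d)" using cd(2) S(2)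
  proof (induction d rule: rev_induct)
    case (snoc s d)
    then show ?case
      using factor_of_mult_right[OF J I p(2) w(3), of s "w \<otimes> wp d"] p(2) by (simp add: m_assoc)
  qed (use p(2) in simp)
  then have "factor_of J I w (wp c \<otimes> (w \<otimes> wp d))" using cd(1) S(1)
  proof (induction c)
    case (Cons s c)
    then show ?case
      using factor_of_mult_left[OF J I p(2) w(2), of s "wp c \<otimes> (w \<otimes> wp d)"] p(2) S(2)
      by (simp add: m_assoc)
  qed (use p(2) S(2) in simp)
  then show ?thesis using cd(3) p(2) S by (simp add: m_assoc)
qed

lemma all_descents_longest:
  assumes J: "J \<subseteq> S" and I: "I \<subseteq> S" and p: "p \<in> double_cosets G J I"
    and w: "w \<in> p" "J \<subseteq> left_descents G S w" "I \<subseteq> right_descents G S w" and y: "y \<in> p"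
  shows "len y \<le> len w" "len y = len w \<Longrightarrow> y = w"
  using all_descents_factorization[OF assms] unfolding factor_of_def by auto

section \<open>Bruhat-extremal elements\<close>

lemma bruhat_le_len: "bruhat_le G S u w \<Longrightarrow> u = w \<or> len u < len w"
  unfolding bruhat_le_def
  by (induction rule: rtranclp_induct) (auto simp: bruhat_step_def)

text \<open>This and the strict growth of length along the Bruhat order reduce Bruhat extremality to
  descents: an element that is Bruhat-maximal (minimal) in a double coset has all (no) descents
  in \<open>J\<close> and \<open>I\<close>, and such an element is unique.\<close>

lemma bruhat_le_mult:
  assumes "s \<in> S" "x \<in> carrier G"
  shows "len x < len (s \<otimes> x) \<Longrightarrow> bruhat_le G S x (s \<otimes> x)"
    and "len x < len (x \<otimes> s) \<Longrightarrow> bruhat_le G S x (x \<otimes> s)"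
proof -
  have "inv x \<otimes> s \<otimes> x \<in> reflections G S"
    using assms unfolding reflections_def
    by (intro CollectI exI[of _ "inv x"] exI[of _ s]) simp
  moreover have "s \<otimes> x = x \<otimes> (inv x \<otimes> s \<otimes> x)"
    using assms by (simp add: m_assoc inv_solve_left[symmetric])
  ultimately show "len x < len (s \<otimes> x) \<Longrightarrow> bruhat_le G S x (s \<otimes> x)"
    using assms unfolding bruhat_le_def bruhat_step_def by blast
  have "s \<in> reflections G S"
    using assms unfolding reflections_def
    by (intro CollectI exI[of _ \<one>] exI[of _ s]) simp
  then show "len x < len (x \<otimes> s) \<Longrightarrow> bruhat_le G S x (x \<otimes> s)"
    using assms unfolding bruhat_le_def bruhat_step_def by blast
qed

lemma coset_max_eqI:
  assumes J: "J \<subseteq> S" and I: "I \<subseteq> S" and p: "p \<in> double_cosets G J I"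
    and w: "w \<in> p" "J \<subseteq> left_descents G S w" "I \<subseteq> right_descents G S w"
  shows "coset_max G S p = w"
  unfolding coset_max_def
proof (rule the_equality)
  show "w \<in> p \<and> (\<forall>u\<in>p. bruhat_le G S w u \<longrightarrow> u = w)"
    using w(1) bruhat_le_len all_descents_longest(1)[OF J I p w] by (metis leD)
next
  fix v assume v: "v \<in> p \<and> (\<forall>u\<in>p. bruhat_le G S v u \<longrightarrow> u = v)"
  then have vc: "v \<in> carrier G" using double_cosets_eq_dcoset(2)[OF J I p] by blast
  have "len (s \<otimes> v) < len v" if "s \<in> J" for s
  proof (rule ccontr)
    assume "\<not> len (s \<otimes> v) < len v"
    moreover have s: "s \<in> S" using that J by auto
    ultimately have less: "len v < len (s \<otimes> v)" using len_mult_S(1)[OF s vc] by auto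
    have "s \<otimes> v \<in> p" using double_cosets_mult(1)[OF J I p _ parabolic_S[OF that]] v by blast
    then have "s \<otimes> v = v" using v bruhat_le_mult(1)[OF s vc less] by blast
    then show False using less by simp
  qed
  then have l: "J \<subseteq> left_descents G S v" using J by (auto simp: left_descents_def)
  have "len (v \<otimes> s) < len v" if "s \<in> I" for s
  proof (rule ccontr)
    assume "\<not> len (v \<otimes> s) < len v"
    moreover have s: "s \<in> S" using that I by auto
    ultimately have less: "len v < len (v \<otimes> s)" using len_mult_S(2)[OF s vc] by auto
    have "v \<otimes> s \<in> p" using double_cosets_mult(2)[OF J I p _ parabolic_S[OF that]] v by blast
    then have "v \<otimes> s = v" using v bruhat_le_mult(2)[OF s vc less] by blast
    then show False using less by simp
  qed
  then have r: "I \<subseteq> right_descents G S v" using I by (auto simp: right_descents_def)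
  have "len w \<le> len v" using all_descents_longest(1)[OF J I p _ l r] v w by blast
  moreover have "len v \<le> len w" using all_descents_longest(1)[OF J I p w] v by blast
  ultimately show "v = w" using all_descents_longest(2)[OF J I p w] v by auto
qed

lemma coset_max_in:
  assumes J: "finitary G S J" and I: "finitary G S I" and p: "p \<in> double_cosets G J I"
  shows "coset_max G S p \<in> p" "J \<subseteq> left_descents G S (coset_max G S p)"
    "I \<subseteq> right_descents G S (coset_max G S p)"
proof -
  have JI: "J \<subseteq> S" "I \<subseteq> S" "finite (generate G J)" "finite (generate G I)"
    using J I by (auto simp: finitary_def)
  obtain v where v: "v \<in> p" using double_cosets_nonempty p by blast
  have "p = dcoset J v I" using double_cosets_eq_dcoset(1)[OF JI(1,2) p v] .
  also have "\<dots> = (\<Union>a\<in>generate G J. \<Union>b\<in>generate G I. {a \<otimes> v \<otimes> b})"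
    unfolding set_eq_iff mem_dcoset by simp
  finally have "finite p" using JI by auto
  then have "Max (len ` p) \<in> len ` p" using v by (intro Max_in) auto
  then obtain w where w: "w \<in> p" "len w = Max (len ` p)" by auto
  have longest: "len u \<le> len w" if "u \<in> p" for u using w that \<open>finite p\<close> by simp
  have wc: "w \<in> carrier G" using double_cosets_eq_dcoset(2)[OF JI(1,2) p w(1)] .
  have "len (s \<otimes> w) < len w" if "s \<in> J" for s
    using longest[OF double_cosets_mult(1)[OF JI(1,2) p w(1) parabolic_S[OF that]]]
      len_mult_S(1)[of s w] that JI wc by auto
  then have l: "J \<subseteq> left_descents G S w" using JI by (auto simp: left_descents_def)
  have "len (w \<otimes> s) < len w" if "s \<in> I" for s
    using longest[OF double_cosets_mult(2)[OF JI(1,2) p w(1) parabolic_S[OF that]]]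
      len_mult_S(2)[of s w] that JI wc by auto
  then have r: "I \<subseteq> right_descents G S w" using JI by (auto simp: right_descents_def)
  have "coset_max G S p = w" by (rule coset_max_eqI[OF JI(1,2) p w(1) l r])
  then show "coset_max G S p \<in> p" "J \<subseteq> left_descents G S (coset_max G S p)"
    "I \<subseteq> right_descents G S (coset_max G S p)" using w l r by auto
qed

lemma coset_min_eqI:
  assumes J: "J \<subseteq> S" and I: "I \<subseteq> S" and p: "p \<in> double_cosets G J I"
    and w: "w \<in> p" "J \<inter> left_descents G S w = {}" "I \<inter> right_descents G S w = {}"
  shows "coset_min G S p = w"
  unfolding coset_min_def
proof (rule the_equality)
  have "len w \<le> len y" if "y \<in> p" for y
    using no_descents_factorization[OF J I p w that] by auto
  then show "w \<in> p \<and> (\<forall>u\<in>p. bruhat_le G S u w \<longrightarrow> u = w)"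
    using w(1) bruhat_le_len by (meson leD)
next
  fix v assume v: "v \<in> p \<and> (\<forall>u\<in>p. bruhat_le G S u v \<longrightarrow> u = v)"
  then have vc: "v \<in> carrier G" using double_cosets_eq_dcoset(2)[OF J I p] by blast
  have "\<not> len (s \<otimes> v) < len v" if "s \<in> J" for s
  proof
    assume less: "len (s \<otimes> v) < len v"
    have s: "s \<in> S" using that J by auto
    have "s \<otimes> v \<in> p" using double_cosets_mult(1)[OF J I p _ parabolic_S[OF that]] v by blast
    moreover have "bruhat_le G S (s \<otimes> v) v"
      using bruhat_le_mult(1)[OF s, of "s \<otimes> v"] s vc less by simp
    ultimately have "s \<otimes> v = v" using v by blast
    then show False using less by simp
  qed
  then have l: "J \<inter> left_descents G S v = {}" by (auto simp: left_descents_def)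
  have "\<not> len (v \<otimes> s) < len v" if "s \<in> I" for s
  proof
    assume less: "len (v \<otimes> s) < len v"
    have s: "s \<in> S" using that I by auto
    have "v \<otimes> s \<in> p" using double_cosets_mult(2)[OF J I p _ parabolic_S[OF that]] v by blast
    moreover have "bruhat_le G S (v \<otimes> s) v"
      using bruhat_le_mult(2)[OF s, of "v \<otimes> s"] s vc less by simp
    ultimately have "v \<otimes> s = v" using v by blast
    then show False using less by simp
  qed
  then have r: "I \<inter> right_descents G S v = {}" by (auto simp: right_descents_def)
  show "v = w" using no_descents_unique[OF J I p w _ l r] v by blast
qed

lemma coset_min_in:
  assumes J: "J \<subseteq> S" and I: "I \<subseteq> S" and p: "p \<in> double_cosets G J I"
  shows "coset_min G S p \<in> p" "J \<inter> left_descents G S (coset_min G S p) = {}"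
    "I \<inter> right_descents G S (coset_min G S p) = {}"
proof -
  obtain x where x: "x \<in> p" "\<And>y. y \<in> p \<Longrightarrow> len x \<le> len y" using min_length_exists[OF p] by blast
  note d = min_length_no_descents[OF J I p x]
  have "coset_min G S p = x" by (rule coset_min_eqI[OF J I p x(1) d])
  then show "coset_min G S p \<in> p" "J \<inter> left_descents G S (coset_min G S p) = {}"
    "I \<inter> right_descents G S (coset_min G S p) = {}" using x d by auto
qed

section \<open>Reducedness of an ascending step\<close>

lemma coset_rep_factorization:
  assumes J: "J \<subseteq> S" and I: "I \<subseteq> S" and p: "p \<in> double_cosets G J I"
    and z: "z \<in> p" "I \<inter> right_descents G S z = {}"
  shows "\<exists>a\<in>generate G J. z = a \<otimes> coset_min G S p"
proof -
  note x = coset_min_in[OF J I p]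
  have xc: "coset_min G S p \<in> carrier G" using double_cosets_eq_dcoset(2)[OF J I p x(1)] .
  obtain a b where ab: "set a \<subseteq> J" "set b \<subseteq> I" "z = wp a \<otimes> coset_min G S p \<otimes> wp b"
    "len z = length a + len (coset_min G S p) + length b"
    using no_descents_factorization[OF J I p x z(1)] by blast
  have S: "set a \<subseteq> S" "set b \<subseteq> S" using ab J I by auto
  have "b = []"
  proof (rule ccontr)
    assume "b \<noteq> []"
    then obtain s c where b: "b = c @ [s]" by (metis rev_exhaust)
    have s: "s \<in> S" "s \<in> I" and cS: "set c \<subseteq> S" using b ab S by auto
    have "z \<otimes> s = wp a \<otimes> coset_min G S p \<otimes> wp c" using ab b s cS S xc by (simp add: m_assoc)
    then have "len (z \<otimes> s) \<le> length a + len (coset_min G S p) + length c"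
      using len_mult_le[of "wp a \<otimes> coset_min G S p" "wp c"] len_mult_le[of "wp a" "coset_min G S p"]
        len_le[of c] len_le[of a] cS S xc by simp
    then show False using ab b s z(2) unfolding right_descents_def by auto
  qed
  then show ?thesis using ab xc S wp_parabolic[OF J ab(1)] by auto
qed

lemma right_coset_min:
  assumes I: "I \<subseteq> S" and z: "z \<in> carrier G"
  shows "\<exists>v\<in>generate G I. I \<inter> right_descents G S (z \<otimes> v) = {}"
proof -
  have p: "dcoset {} z I \<in> double_cosets G {} I" using z by (rule dcoset_in_double_cosets)
  note m = coset_min_in[OF _ I p]
  have "\<exists>v\<in>generate G I. coset_min G S (dcoset {} z I) = z \<otimes> v"
    using m(1) z unfolding mem_dcoset[of _ "{}"] by (auto simp: generate_empty)
  then obtain v where "v \<in> generate G I" "coset_min G S (dcoset {} z I) = z \<otimes> v" by blast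
  then show ?thesis using m(3) by auto
qed

text \<open>For \<open>I \<subseteq> I'\<close>: the shortest element of \<open>z W\<^sub>I\<close> is also shortest in
  \<open>z W\<^sub>I\<^sub>'\<close>. For the longest element \<open>z\<close> of a \<open>(J,I)\<close>-coset this is equivalent to
  reducedness of the step from \<open>I\<close> to \<open>I'\<close>, and it does not mention \<open>J\<close>.\<close>

definition rep_remains_minimal where
  "rep_remains_minimal I' I z \<longleftrightarrow> (\<exists>v\<in>generate G I. I' \<inter> right_descents G S (z \<otimes> v) = {})"

text \<open>Let \<open>x\<close> be the common shortest element and \<open>a x\<close>, with \<open>a \<in> W\<^sub>J\<close>, the
  shortest element of \<open>z W\<^sub>I\<close>. A descent \<open>t \<in> I'\<close> of \<open>a x\<close> is not a descent of
  \<open>x\<close>, so the exchange takes place inside \<open>a\<close> and \<open>r = x t x\<^sup>-\<^sup>1\<close> lies in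
  \<open>W\<^sub>J\<close>. Comparing lengths in \<open>r x = x t\<close> gives \<open>r \<in> J\<close>, so \<open>r\<close> belongs to the
  left redundancy; as this does not grow, \<open>t \<in> I\<close>, a contradiction.\<close>

lemma reduced_step_imp_rep_minimal:
  assumes J: "J \<subseteq> S" and I': "I' \<subseteq> S" and II': "I \<subseteq> I'"
    and q: "q \<in> double_cosets G J I" and q': "q' \<in> double_cosets G J I'"
    and min: "coset_min G S q = coset_min G S q'"
    and red: "left_redundancy G S J I q = left_redundancy G S J I' q'"
    and z: "z \<in> q"
  shows "rep_remains_minimal I' I z"
proof -
  have I: "I \<subseteq> S" using I' II' by auto
  have zc: "z \<in> carrier G" using double_cosets_eq_dcoset(2)[OF J I q z] .
  obtain v where v: "v \<in> generate G I" "I \<inter> right_descents G S (z \<otimes> v) = {}"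
    using right_coset_min[OF I zc] by blast
  define x where "x = coset_min G S q"
  note xq = coset_min_in[OF J I q, folded x_def]
  note xq' = coset_min_in[OF J I' q', folded min, folded x_def]
  have xc: "x \<in> carrier G" using double_cosets_eq_dcoset(2)[OF J I q xq(1)] .
  have "z \<otimes> v \<in> q" using double_cosets_mult(2)[OF J I q z v(1)] .
  then obtain a where a: "a \<in> generate G J" "z \<otimes> v = a \<otimes> x"
    using coset_rep_factorization[OF J I q _ v(2)] x_def by blast
  have ac: "a \<in> carrier G" using a J by simp
  have "I' \<inter> right_descents G S (a \<otimes> x) = {}"
  proof (rule ccontr)
    assume "I' \<inter> right_descents G S (a \<otimes> x) \<noteq> {}"
    then obtain t where t: "t \<in> I'" "t \<in> S" "len (a \<otimes> x \<otimes> t) < len (a \<otimes> x)"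
      by (auto simp: right_descents_def)
    have xt: "len (x \<otimes> t) = len x + 1"
      using len_mult_S(2)[OF t(2) xc] xq'(3) t by (auto simp: right_descents_def)
    have lax: "len (a \<otimes> x) = len a + len x" using len_mult_left[OF J xc xq(2) a(1)] .
    obtain b where b: "set b \<subseteq> J" "wp b = a" "length b = len a"
      using parabolic_reduced_word[OF J a(1)] by blast
    obtain e where e: "set e \<subseteq> S" "wp e = x" "length e = len x" using reduced_word[OF xc] by blast
    have be: "set (b @ e) \<subseteq> S" "wp (b @ e) = a \<otimes> x" using b e J by auto
    obtain u where u: "subseq u (b @ e)" "length (b @ e) = length u + 1" "a \<otimes> x \<otimes> t = wp u"
      using exchange_right[OF be(1) t(2)] t(3) unfolding be(2) by blast
    obtain b' e' where be': "u = b' @ e'" "subseq b' b" "subseq e' e"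
      using u(1) subseq_append_iff[of u b e] by blast
    have sets: "set b' \<subseteq> J" "set b' \<subseteq> S" "set e' \<subseteq> S"
      using subseq_S[OF be'(2)] subseq_S[OF be'(3)] b e J by auto
    have eq: "a \<otimes> (x \<otimes> t) = wp b' \<otimes> wp e'" using u(3) be'(1) sets ac xc t(2) by (simp add: m_assoc)
    \<comment> \<open>The deleted letter is one of \<open>a\<close>, because \<open>t\<close> lengthens \<open>x\<close>.\<close>
    have "e' = e"
    proof (rule ccontr)
      assume "e' \<noteq> e"
      then have less: "length e' < length e"
        using be'(3) by (metis list_emb_length subseq_same_length order_le_less)
      then have "length b \<le> length b'" using u(2) be' by simp
      then have "b' = b" using be'(2) by (meson list_emb_length subseq_same_length order_antisym)
      then have "x \<otimes> t = wp e'" using eq b ac xc t sets by simp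
      then show False using len_le[OF sets(3)] less e xt by simp
    qed
    define r where "r = inv a \<otimes> wp b'"
    have rJ: "r \<in> generate G J"
      unfolding r_def using sets a J by (intro parabolic_mult parabolic_inv wp_parabolic)
    have rx: "r \<otimes> x = x \<otimes> t"
    proof -
      have "r \<otimes> x = inv a \<otimes> (wp b' \<otimes> x)" using ac sets xc by (simp add: r_def m_assoc)
      also have "wp b' \<otimes> x = a \<otimes> (x \<otimes> t)" using eq \<open>e' = e\<close> e(2) by simp
      also have "inv a \<otimes> (a \<otimes> (x \<otimes> t)) = x \<otimes> t"
        using ac xc t(2) by (simp add: m_assoc[symmetric])
      finally show ?thesis .
    qed
    have "len r + len x = len x + 1"
      using len_mult_left[OF J xc xq(2) rJ] xt rx by simp
    then have "r \<in> J" using len_one_parabolic[OF J rJ] by simp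
    moreover have conj: "r = x \<otimes> t \<otimes> inv x"
      using rx rJ J xc t by (metis inv_solve_right m_closed parabolic_closed S_closed)
    ultimately have "r \<in> left_redundancy G S J I' q'"
      using t(1) unfolding left_redundancy_def min[symmetric] x_def[symmetric] by blast
    then have "r \<in> left_redundancy G S J I q" by (simp add: red)
    then obtain t' where t': "t' \<in> I" "r = x \<otimes> t' \<otimes> inv x"
      unfolding left_redundancy_def x_def[symmetric] by blast
    have "t' \<in> S" using t' I by auto
    then have "t' = t" using t'(2) conj xc t(2) by simp
    then have "t \<in> I \<inter> right_descents G S (z \<otimes> v)"
      using t' t unfolding a(2) by (auto simp: right_descents_def)
    then show False using v(2) by blast
  qed
  then have "I' \<inter> right_descents G S (z \<otimes> v) = {}" by (simp add: a(2))
  then show ?thesis using v(1) unfolding rep_remains_minimal_def by blast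
qed

text \<open>Let \<open>a x\<close> be the shortest element of \<open>z W\<^sub>I\<close>, where \<open>x\<close> is the shortest
  element of \<open>r\<close>. A descent of \<open>x\<close> in \<open>I'\<close> would be one of \<open>a x\<close>, so
  \<open>x\<close> is still shortest in \<open>r'\<close>. If the redundancy grew, there would be
  \<open>s = x t x\<^sup>-\<^sup>1\<close> in \<open>J\<close> with \<open>t\<close> in \<open>I'\<close> but not in \<open>I\<close>. Writing
  \<open>z = a x b\<close> with \<open>b \<in> W\<^sub>I\<close>, the element \<open>a s x b = a x t b\<close> of \<open>r\<close> would be
  longer than \<open>z\<close>, because \<open>t b\<close> is longer than \<open>b\<close>.\<close>

lemma rep_minimal_imp_reduced_step:
  assumes J: "J \<subseteq> S" and I': "I' \<subseteq> S" and II': "I \<subseteq> I'"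
    and r: "r \<in> double_cosets G J I" and r': "r' \<in> double_cosets G J I'" and sub: "r \<subseteq> r'"
    and z: "z \<in> r" "J \<subseteq> left_descents G S z" "I \<subseteq> right_descents G S z"
    and rep: "rep_remains_minimal I' I z"
  shows "coset_min G S r = coset_min G S r'"
    and "left_redundancy G S J I r = left_redundancy G S J I' r'"
proof -
  have I: "I \<subseteq> S" using I' II' by auto
  have zc: "z \<in> carrier G" using double_cosets_eq_dcoset(2)[OF J I r z(1)] .
  obtain v where v: "v \<in> generate G I" "I' \<inter> right_descents G S (z \<otimes> v) = {}"
    using rep unfolding rep_remains_minimal_def by blast
  define x where "x = coset_min G S r"
  note xr = coset_min_in[OF J I r, folded x_def]
  have xc: "x \<in> carrier G" using double_cosets_eq_dcoset(2)[OF J I r xr(1)] .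
  have vc: "v \<in> carrier G" using v I by simp
  have zr: "z \<otimes> v \<in> r" using double_cosets_mult(2)[OF J I r z(1) v(1)] .
  then obtain a where a: "a \<in> generate G J" "z \<otimes> v = a \<otimes> x"
    using coset_rep_factorization[OF J I r _] v(2) II' x_def by blast
  have ac: "a \<in> carrier G" using a J by simp
  have lax: "len (a \<otimes> x) = len a + len x" using len_mult_left[OF J xc xr(2) a(1)] .
  have no: "len (a \<otimes> x) < len (a \<otimes> x \<otimes> t)" if "t \<in> I'" for t
    using v(2) that I' len_mult_S(2)[of t "a \<otimes> x"] ac xc
    unfolding a(2) right_descents_def by fastforce
  have "I' \<inter> right_descents G S x = {}"
  proof (rule ccontr)
    assume "I' \<inter> right_descents G S x \<noteq> {}"
    then obtain t where t: "t \<in> I'" "t \<in> S" "len (x \<otimes> t) < len x"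
      by (auto simp: right_descents_def)
    have "len (a \<otimes> x \<otimes> t) \<le> len a + len (x \<otimes> t)"
      using len_mult_le[of a "x \<otimes> t"] ac xc t by (simp add: m_assoc)
    then show False using no[OF t(1)] t lax by simp
  qed
  then have min': "coset_min G S r' = x"
    using coset_min_eqI[OF J I' r' _ xr(2)] xr(1) sub by blast
  then show "coset_min G S r = coset_min G S r'" by (simp add: x_def)
  have "t \<in> I" if s: "s \<in> J" and t: "t \<in> I'" "s = x \<otimes> t \<otimes> inv x" for s t
  proof (rule ccontr)
    assume "t \<notin> I"
    have sS: "s \<in> S" and tS: "t \<in> S" using s t J I' by auto
    have sx: "s \<otimes> x = x \<otimes> t" using t(2) xc tS by (simp add: m_assoc)
    define b where "b = inv v"
    have b: "b \<in> generate G I" unfolding b_def using v(1) I by (intro parabolic_inv)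
    then have b': "b \<in> generate G I'" using mono_generate[OF II'] by blast
    have bc: "b \<in> carrier G" using b I by simp
    have zb: "z = a \<otimes> x \<otimes> b" using zc vc unfolding b_def a(2)[symmetric] by (simp add: m_assoc)
    have lz: "len z = len (a \<otimes> x) + len b"
      unfolding zb using len_mult_right[OF I' _ _ b'] v(2) ac xc a(2) by simp
    have tb: "len (t \<otimes> b) = len b + 1"
    proof (rule ccontr)
      assume "len (t \<otimes> b) \<noteq> len b + 1"
      then have less: "len (t \<otimes> b) < len b" using len_mult_S(1)[OF tS bc] by auto
      obtain d where d: "set d \<subseteq> I" "wp d = b" using b generate_words[OF I] by auto
      obtain d' where d': "subseq d' d" "t \<otimes> b = wp d'"
        using exchange_left[of d t] less d I tS by auto
      have "t \<otimes> b \<in> generate G I" using d' subseq_S[OF d'(1) d(1)] I wp_parabolic by simp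
      then have "t \<otimes> b \<otimes> inv b \<in> generate G I"
        by (rule parabolic_mult[OF I _ parabolic_inv[OF I b]])
      then have "t \<in> generate G I" using tS bc by (simp add: m_assoc)
      then show False using len_one_parabolic[OF I] len_S[OF tS] \<open>t \<notin> I\<close> by blast
    qed
    have tb': "t \<otimes> b \<in> generate G I'" by (rule parabolic_mult[OF I' parabolic_S[OF t(1)] b'])
    have "len (a \<otimes> x \<otimes> (t \<otimes> b)) = len (a \<otimes> x) + len (t \<otimes> b)"
      using len_mult_right[OF I' _ _ tb'] v(2) ac xc a(2) by simp
    then have longer: "len z < len (a \<otimes> x \<otimes> (t \<otimes> b))" using lz tb by simp
    have "a \<otimes> x \<otimes> (t \<otimes> b) = a \<otimes> (x \<otimes> t) \<otimes> b" using ac xc tS bc by (simp add: m_assoc)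
    also have "\<dots> = (a \<otimes> s) \<otimes> x \<otimes> b" using ac xc sS bc unfolding sx[symmetric] by (simp add: m_assoc)
    finally have "a \<otimes> x \<otimes> (t \<otimes> b) = (a \<otimes> s) \<otimes> x \<otimes> b" .
    moreover have "(a \<otimes> s) \<otimes> x \<otimes> b \<in> r"
      using double_cosets_mult[OF J I r] xr(1) a(1) b s J
      by (meson parabolic_mult parabolic_S)
    ultimately have "a \<otimes> x \<otimes> (t \<otimes> b) \<in> r" by simp
    then show False using all_descents_longest(1)[OF J I r z] longer by (meson leD)
  qed
  then show "left_redundancy G S J I r = left_redundancy G S J I' r'"
    using II' unfolding left_redundancy_def min' x_def[symmetric] by blast
qed

text \<open>As \<open>z\<close> already has all descents in \<open>J\<close>, only the right factor can lengthen it.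
  Hence the longest element of \<open>q'\<close> lies in \<open>z W\<^sub>I\<^sub>'\<close> and so
  stays in the coset when \<open>J\<close> is replaced by a subset.\<close>

lemma longest_extends_right:
  assumes J: "J \<subseteq> S" and I': "I' \<subseteq> S" and q': "q' \<in> double_cosets G J I'"
    and z: "z \<in> q'" "J \<subseteq> left_descents G S z"
    and w: "w \<in> q'" "J \<subseteq> left_descents G S w" "I' \<subseteq> right_descents G S w"
  shows "\<exists>b\<in>generate G I'. w = z \<otimes> b"
proof -
  obtain a b where ab: "z \<in> carrier G" "set a \<subseteq> J" "set b \<subseteq> I'" "w = wp a \<otimes> z \<otimes> wp b"
    "len w = length a + len z + length b"
    using all_descents_factorization[OF J I' q' w z(1)] unfolding factor_of_def by blast
  have S: "set a \<subseteq> S" "set b \<subseteq> S" using ab J I' by auto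
  have "a = []"
  proof (rule ccontr)
    assume "a \<noteq> []"
    then obtain c s where a: "a = c @ [s]" by (metis rev_exhaust)
    have s: "s \<in> S" "s \<in> J" and cS: "set c \<subseteq> S" using a ab S by auto
    have "w = wp c \<otimes> (s \<otimes> z) \<otimes> wp b" using ab a s cS S by (simp add: m_assoc)
    then have "len w \<le> length c + len (s \<otimes> z) + length b"
      using len_mult_le[of "wp c \<otimes> (s \<otimes> z)" "wp b"] len_mult_le[of "wp c" "s \<otimes> z"]
        len_le[of b] len_le[of c] cS S ab s by simp
    moreover have "len (s \<otimes> z) < len z" using z(2) s by (auto simp: left_descents_def)
    ultimately show False using ab a by simp
  qed
  then show ?thesis using ab wp_parabolic[OF I' ab(3)] by auto
qed

section \<open>Reduced paths\<close>

lemma double_cosets_eq: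
  assumes "J \<subseteq> S" "I \<subseteq> S" "p \<in> double_cosets G J I" "p' \<in> double_cosets G J I" "w \<in> p" "w \<in> p'"
  shows "p = p'"
  using double_cosets_eq_dcoset(1)[OF assms(1,2,3,5)] double_cosets_eq_dcoset(1)[OF assms(1,2,4,6)]
  by simp

lemma dcoset_mono: "I \<subseteq> I' \<Longrightarrow> dcoset J w I \<subseteq> dcoset J w I'"
  using mono_generate[of I I'] unfolding mem_dcoset subset_iff by blast

definition adjacent where
  "adjacent I I' \<longleftrightarrow> (\<exists>s\<in>S. s \<notin> I \<and> I' = insert s I \<or> s \<notin> I' \<and> I = insert s I')"

lemma adjacentE:
  assumes "adjacent I I'"
  obtains "I \<subset> I'" | "I' \<subset> I"
  using assms unfolding adjacent_def by blast

definition reduced_step where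
  "reduced_step J I I' p p' \<longleftrightarrow> adjacent I I' \<and>
     (I \<subset> I' \<longrightarrow> p \<subseteq> p' \<and> coset_min G S p = coset_min G S p' \<and>
        left_redundancy G S J I p = left_redundancy G S J I' p') \<and>
     (I' \<subset> I \<longrightarrow> coset_max G S p \<in> p')"

text \<open>The current set and the current coset are kept apart from the lists of the earlier ones.
  Concatenation, which identifies the last set of one expression with the first of the next,
  then becomes plain appending of the lists.\<close>

inductive reduced_path for J where
  start: "\<lbrakk>finitary G S J; p \<in> double_cosets G J J; \<one> \<in> p\<rbrakk> \<Longrightarrow> reduced_path J [] J [] p"
| step: "\<lbrakk>reduced_path J Is I ps p; finitary G S I'; p' \<in> double_cosets G J I';
     reduced_step J I I' p p'\<rbrakk> \<Longrightarrow> reduced_path J (Is @ [I]) I' (ps @ [p]) p'"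

text \<open>All conditions on consecutive entries are gathered in \<open>reduced_step\<close>, so that
  extending a path by one entry adds a single step condition.\<close>

definition reduced_forward_path where
  "reduced_forward_path Is ps \<longleftrightarrow> Is \<noteq> [] \<and> length ps = length Is \<and>
     (\<forall>i<length Is. finitary G S (Is ! i) \<and> ps ! i \<in> double_cosets G (Is ! 0) (Is ! i)) \<and>
     \<one> \<in> ps ! 0 \<and>
     (\<forall>i. Suc i < length Is \<longrightarrow> reduced_step (Is ! 0) (Is ! i) (Is ! Suc i) (ps ! i) (ps ! Suc i))"

lemma reduced_forward_path_iff:
  "reduced_forward_path Is ps \<longleftrightarrow> expression G S Is \<and> forward_path G S Is ps \<and>
     (\<forall>i. Suc i < length Is \<and> Is ! i \<subset> Is ! Suc i \<longrightarrow>
        coset_min G S (ps ! i) = coset_min G S (ps ! Suc i) \<and>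
        left_redundancy G S (Is ! 0) (Is ! i) (ps ! i) =
          left_redundancy G S (Is ! 0) (Is ! Suc i) (ps ! Suc i))"
  unfolding reduced_forward_path_def expression_def forward_path_def reduced_step_def adjacent_def
    all_set_conv_all_nth by blast

lemma reduced_forward_path_snoc:
  assumes "length ps = length Is"
  shows "reduced_forward_path (Is @ [I, I']) (ps @ [p, p']) \<longleftrightarrow>
    reduced_forward_path (Is @ [I]) (ps @ [p]) \<and> finitary G S I' \<and>
    p' \<in> double_cosets G ((Is @ [I]) ! 0) I' \<and> reduced_step ((Is @ [I]) ! 0) I I' p p'"
proof -
  let ?Is = "Is @ [I, I']" and ?ps = "ps @ [p, p']"
  have hd: "?Is ! 0 = (Is @ [I]) ! 0" "?ps ! 0 = (ps @ [p]) ! 0"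
    using assms by (auto simp: nth_append)
  have all_Suc: "(\<forall>i<Suc n. P i) \<longleftrightarrow> (\<forall>i<n. P i) \<and> P n" for P and n :: nat
    using less_Suc_eq by auto
  have old: "?Is ! i = (Is @ [I]) ! i" "?ps ! i = (ps @ [p]) ! i" if "i < Suc (length Is)" for i
    using that assms by (auto simp: nth_append less_Suc_eq)
  have new: "?Is ! Suc (length Is) = I'" "?ps ! Suc (length Is) = p'"
    "(Is @ [I]) ! length Is = I" "(ps @ [p]) ! length Is = p"
    using assms by (auto simp: nth_append)
  show ?thesis
    unfolding reduced_forward_path_def hd using assms old new
    by (simp add: all_Suc del: append.simps nth_append_length) blast
qed

lemma reduced_path_imp_forward:
  assumes "reduced_path J Is I ps p"
  shows "length ps = length Is \<and> (Is @ [I]) ! 0 = J \<and> reduced_forward_path (Is @ [I]) (ps @ [p])"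
  using assms
proof induction
  case (start p)
  then show ?case by (simp add: reduced_forward_path_def)
next
  case (step Is I ps p I' p')
  then show ?case using reduced_forward_path_snoc[of ps Is I I' p p']
    by (auto simp: nth_append)
qed

lemma reduced_forward_path_imp:
  assumes "reduced_forward_path (Is @ [I]) (ps @ [p])"
  shows "reduced_path ((Is @ [I]) ! 0) Is I ps p"
  using assms
proof (induction Is arbitrary: I ps p rule: rev_induct)
  case Nil
  then show ?case by (auto simp: reduced_forward_path_def intro: reduced_path.start)
next
  case (snoc I Is I' ps p')
  have len: "length ps = length Is + 1" using snoc.prems by (simp add: reduced_forward_path_def)
  then obtain qs p where ps: "ps = qs @ [p]" by (metis Suc_eq_plus1 length_Suc_conv_rev)
  then have l: "length qs = length Is" using len by simp
  have *: "reduced_forward_path (Is @ [I]) (qs @ [p])" "finitary G S I'"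
    "p' \<in> double_cosets G ((Is @ [I]) ! 0) I'" "reduced_step ((Is @ [I]) ! 0) I I' p p'"
    using snoc.prems reduced_forward_path_snoc[OF l, of I I' p p'] ps by auto
  have "reduced_path ((Is @ [I]) ! 0) (Is @ [I]) I' (qs @ [p]) p'"
    using snoc.IH[OF *(1)] *(2-4) by (rule reduced_path.step)
  then show ?case using ps by (cases "Is = []") (simp_all add: nth_append)
qed

lemma reduced_path_last:
  assumes "reduced_path J Is I ps p"
  shows "finitary G S I" "p \<in> double_cosets G J I" "finitary G S J"
  using assms by (induction) auto

lemma forward_path_unique:
  assumes e: "expression G S Is" and f: "forward_path G S Is ps" "forward_path G S Is qs"
  shows "ps = qs"
proof (rule nth_equalityI)
  show "length ps = length qs" using f by (simp add: forward_path_def)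
  have fin: "Is ! i \<subseteq> S" "finitary G S (Is ! i)" if "i < length Is" for i
    using e that unfolding expression_def finitary_def by auto
  have eq: "ps ! i = qs ! i" if "i < length Is" for i
    using that
  proof (induction i)
    case 0
    then show ?case
      using f fin[OF 0] double_cosets_eq[of "Is ! 0" "Is ! 0" _ _ \<one>]
      unfolding forward_path_def by blast
  next
    case (Suc i)
    have IH: "ps ! i = qs ! i" using Suc by simp
    have 0: "0 < length Is" and i: "i < length Is" using Suc.prems by auto
    have d: "ps ! i \<in> double_cosets G (Is ! 0) (Is ! i)"
      "ps ! Suc i \<in> double_cosets G (Is ! 0) (Is ! Suc i)"
      "qs ! Suc i \<in> double_cosets G (Is ! 0) (Is ! Suc i)"
      using f Suc.prems i unfolding forward_path_def by auto
    obtain w where w: "w \<in> ps ! i" using double_cosets_nonempty[OF d(1)] by blast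
    have "adjacent (Is ! i) (Is ! Suc i)"
      using e Suc.prems unfolding expression_def adjacent_def by blast
    then have "\<exists>w. w \<in> ps ! Suc i \<and> w \<in> qs ! Suc i"
    proof (cases rule: adjacentE)
      case 1
      then show ?thesis using f Suc.prems w IH unfolding forward_path_def by blast
    next
      case 2
      then show ?thesis using f Suc.prems IH unfolding forward_path_def by metis
    qed
    then show ?case using double_cosets_eq[OF fin(1)[OF 0] fin(1)[OF Suc.prems] d(2,3)] by blast
  qed
  then show "\<And>i. i < length ps \<Longrightarrow> ps ! i = qs ! i" using f by (simp add: forward_path_def)
qed

section \<open>Composing the three expressions\<close>

lemma dcoset_one_min:
  assumes "J \<subseteq> I" "I \<subseteq> S"
  shows "coset_min G S (dcoset J \<one> I) = \<one>" "left_redundancy G S J I (dcoset J \<one> I) = J"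
proof -
  show min: "coset_min G S (dcoset J \<one> I) = \<one>"
    using assms by (intro coset_min_eqI[of J I] dcoset_in_double_cosets dcoset_refl)
      (auto simp: left_descents_def right_descents_def)
  have "(\<lambda>s. \<one> \<otimes> s \<otimes> inv \<one>) ` I = id ` I" using assms by (intro image_cong) auto
  then show "left_redundancy G S J I (dcoset J \<one> I) = J"
    using assms(1) unfolding left_redundancy_def min by auto
qed

text \<open>Every coset on the path contains \<open>1\<close>, so its shortest element is \<open>1\<close> and its
  left redundancy is \<open>J\<close>.\<close>

lemma ascending_reduced_path:
  assumes "ascending_expression G S J M As"
  shows "J \<subseteq> M" "\<exists>ps. reduced_path J (butlast As) M ps (dcoset J \<one> M)"
proof -
  have As: "As \<noteq> []" "hd As = J" "last As = M" "expression G S As"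
    "\<And>i. Suc i < length As \<Longrightarrow> As ! i \<subset> As ! Suc i"
    using assms unfolding ascending_expression_def expression_def by auto
  have J0: "As ! 0 = J" using As by (simp add: hd_conv_nth)
  have fin: "finitary G S (As ! i)" if "i < length As" for i
    using As(4) that by (auto simp: expression_def)
  have sub: "J \<subseteq> As ! i" if "i < length As" for i
    using that
  proof (induction i)
    case (Suc i)
    then show ?case using As(5)[of i] by auto
  qed (simp add: J0)
  have inS: "As ! i \<subseteq> S" if "i < length As" for i using fin[OF that] by (simp add: finitary_def)
  have *: "reduced_forward_path As (map (\<lambda>I. dcoset J \<one> I) As)"
    unfolding reduced_forward_path_def reduced_step_def J0
  proof (intro conjI allI impI)
    fix i assume i: "Suc i < length As"
    then have i': "i < length As" by simp
    show "adjacent (As ! i) (As ! Suc i)"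
      using As(4) i unfolding expression_def adjacent_def by blast
    show "map (\<lambda>I. dcoset J \<one> I) As ! i \<subseteq> map (\<lambda>I. dcoset J \<one> I) As ! Suc i"
      using i dcoset_mono[of "As ! i" "As ! Suc i"] As(5)[OF i] by auto
    show "coset_min G S (map (\<lambda>I. dcoset J \<one> I) As ! i) =
        coset_min G S (map (\<lambda>I. dcoset J \<one> I) As ! Suc i)"
      using dcoset_one_min(1)[OF sub inS] i by simp
    show "left_redundancy G S J (As ! i) (map (\<lambda>I. dcoset J \<one> I) As ! i) =
        left_redundancy G S J (As ! Suc i) (map (\<lambda>I. dcoset J \<one> I) As ! Suc i)"
      using dcoset_one_min(2)[OF sub inS] i by simp
    show "coset_max G S (map (\<lambda>I. dcoset J \<one> I) As ! i) \<in> map (\<lambda>I. dcoset J \<one> I) As ! Suc i"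
      if "As ! Suc i \<subset> As ! i"
      using that As(5)[OF i] by blast
  next
    have "0 < length As" using As(1) by simp
    then show "\<one> \<in> map (\<lambda>I. dcoset J \<one> I) As ! 0" using dcoset_refl[of \<one>] by simp
  qed (use As(1) fin dcoset_in_double_cosets[of \<one>] in auto)
  have eq: "As = butlast As @ [M]" using append_butlast_last_id[OF As(1)] As(3) by simp
  have "map (\<lambda>I. dcoset J \<one> I) As = map (\<lambda>I. dcoset J \<one> I) (butlast As) @ [dcoset J \<one> M]"
    by (subst eq) simp
  with * have "reduced_forward_path (butlast As @ [M])
      (map (\<lambda>I. dcoset J \<one> I) (butlast As) @ [dcoset J \<one> M])"
    unfolding eq[symmetric] by simp
  then have "reduced_path ((butlast As @ [M]) ! 0) (butlast As) M
      (map (\<lambda>I. dcoset J \<one> I) (butlast As)) (dcoset J \<one> M)"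
    by (rule reduced_forward_path_imp)
  then show "\<exists>ps. reduced_path J (butlast As) M ps (dcoset J \<one> M)"
    unfolding eq[symmetric] J0 by blast
  show "J \<subseteq> M" using sub[of "length As - 1"] As(1,3) by (simp add: last_conv_nth)
qed

lemma coset_max_down:
  assumes J: "finitary G S J" and I: "finitary G S I" and p: "p \<in> double_cosets G J I"
    and sub: "I' \<subseteq> I" "L \<subseteq> J" and p': "p' \<in> double_cosets G L I'" "coset_max G S p \<in> p'"
  shows "coset_max G S p' = coset_max G S p"
proof -
  have "J \<subseteq> S" "I \<subseteq> S" using J I by (auto simp: finitary_def)
  then show ?thesis
    using coset_max_in[OF J I p] sub by (intro coset_max_eqI[OF _ _ p']) auto
qed

text \<open>The cosets on the path from \<open>M\<close> and on the path from \<open>J\<close> have the same longest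
  elements throughout. Since reducedness of an ascending step depends only on the longest element
  before it, the steps of the second path inherit it from the first.\<close>

lemma transfer_reduced_path:
  assumes q: "reduced_path M Is I qs q" and JM: "J \<subseteq> M"
    and As: "reduced_path J As M rs (dcoset J \<one> M)"
  shows "\<exists>ps p. reduced_path J (As @ Is) I ps p \<and> coset_max G S p = coset_max G S q"
  using q
proof induction
  case (start q)
  have MS: "M \<subseteq> S" using start by (simp add: finitary_def)
  have q: "q = dcoset M \<one> M" using double_cosets_eq_dcoset(1)[OF MS MS start(2,3)] .
  have "coset_max G S q \<in> dcoset M \<one> M" using coset_max_in(1)[OF start(1,1,2)] q by simp
  then obtain a b where ab: "a \<in> generate G M" "b \<in> generate G M" "coset_max G S q = a \<otimes> \<one> \<otimes> b"
    unfolding mem_dcoset by blast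
  then have "coset_max G S q = \<one> \<otimes> \<one> \<otimes> (a \<otimes> b)" "a \<otimes> b \<in> generate G M"
    using MS by (auto intro: parabolic_mult)
  then have "coset_max G S q \<in> dcoset J \<one> M" unfolding mem_dcoset by (metis generate.one)
  then have "coset_max G S (dcoset J \<one> M) = coset_max G S q"
    using coset_max_down[OF start(1,1,2) _ JM] dcoset_in_double_cosets[of \<one>] by blast
  then show ?case using As by auto
next
  case (step Is I qs q I' q')
  then obtain ps p where p: "reduced_path J (As @ Is) I ps p" "coset_max G S p = coset_max G S q"
    by blast
  note fin = reduced_path_last[OF step.hyps(1)] reduced_path_last[OF p(1)] step.hyps(2)
  have S: "M \<subseteq> S" "J \<subseteq> S" "I \<subseteq> S" "I' \<subseteq> S" using fin by (auto simp: finitary_def)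
  define z where "z = coset_max G S q"
  note zq = coset_max_in[OF fin(3,1,2), folded z_def]
  note zp = coset_max_in[OF fin(6,1,5), unfolded p(2), folded z_def]
  have zc: "z \<in> carrier G" using double_cosets_eq_dcoset(2)[OF S(1,3) fin(2) zq(1)] .
  define p' where "p' = dcoset J z I'"
  have p': "p' \<in> double_cosets G J I'" "z \<in> p'"
    using zc unfolding p'_def by (auto intro: dcoset_in_double_cosets dcoset_refl)
  have adj: "adjacent I I'" using step.hyps(4) by (simp add: reduced_step_def)
  have "reduced_step J I I' p p' \<and> coset_max G S p' = coset_max G S q'"
    using adj
  proof (cases rule: adjacentE)
    case 1
    then have II': "I \<subseteq> I'" by blast
    have qq': "q \<subseteq> q'" "coset_min G S q = coset_min G S q'"
      "left_redundancy G S M I q = left_redundancy G S M I' q'"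
      using step.hyps(4) 1 by (auto simp: reduced_step_def)
    have rep: "rep_remains_minimal I' I z"
      by (rule reduced_step_imp_rep_minimal[OF S(1,4) II' fin(2) step.hyps(3) qq'(2,3) zq(1)])
    have pp': "p \<subseteq> p'"
      using double_cosets_eq_dcoset(1)[OF S(2,3) fin(5) zp(1)] dcoset_mono[OF II'] p'_def by simp
    note w = coset_max_in[OF fin(3) step.hyps(2,3)]
    obtain b where b: "b \<in> generate G I'" "coset_max G S q' = z \<otimes> b"
      using longest_extends_right[OF S(1,4) step.hyps(3) _ zq(2) w] qq'(1) zq(1) by blast
    have "coset_max G S q' \<in> p'" using double_cosets_mult(2)[OF S(2,4) p' b(1)] b(2) by simp
    then have "coset_max G S p' = coset_max G S q'"
      using coset_max_eqI[OF S(2,4) p'(1)] w(2,3) JM by blast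
    moreover have "reduced_step J I I' p p'"
      using rep_minimal_imp_reduced_step[OF S(2,4) II' fin(5) p'(1) pp' zp rep] adj pp' 1
      unfolding reduced_step_def by blast
    ultimately show ?thesis by blast
  next
    case 2
    have "z \<in> q'" using step.hyps(4) 2 by (simp add: reduced_step_def z_def)
    then have "coset_max G S q' = z"
      using coset_max_down[OF fin(3,1,2) _ _ step.hyps(3)] 2 z_def by blast
    moreover have "coset_max G S p' = z"
      using coset_max_down[OF fin(6,1,5) _ _ p'(1)] p'(2) 2 p(2) z_def by auto
    moreover have "reduced_step J I I' p p'"
      using adj 2 p'(2) p(2) unfolding reduced_step_def z_def by auto
    ultimately show ?thesis by simp
  qed
  then show ?case using reduced_path.step[OF p(1) step.hyps(2) p'(1)] by auto
qed

text \<open>Reducedness constrains ascending steps only, and the longest element is kept: it still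
  has all the descents that the smaller set requires.\<close>

lemma descending_reduced_path:
  assumes "reduced_path J Is N ps p" "descending_expression G S N I (N # Ds)"
  shows "\<exists>ps' p'. reduced_path J (Is @ butlast (N # Ds)) I ps' p' \<and>
    coset_max G S p' = coset_max G S p"
  using assms
proof (induction Ds arbitrary: Is N ps p)
  case Nil
  then show ?case by (auto simp: descending_expression_def)
next
  case (Cons N' Ds)
  note d = Cons.prems(2)[unfolded descending_expression_def expression_def]
  have sub: "N' \<subset> N"
    using d[THEN conjunct2, THEN conjunct2, THEN conjunct2, rule_format, of 0] by simp
  have adj: "adjacent N N'"
    using d[THEN conjunct1, THEN conjunct2, THEN conjunct2, rule_format, of 0]
    by (simp add: adjacent_def)
  have fin': "finitary G S N'" using d by simp
  have tail: "descending_expression G S N' I (N' # Ds)"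
    unfolding descending_expression_def expression_def
  proof (intro conjI allI impI)
    fix i assume i: "Suc i < length (N' # Ds)"
    show "(N' # Ds) ! Suc i \<subset> (N' # Ds) ! i"
      using d[THEN conjunct2, THEN conjunct2, THEN conjunct2, rule_format, of "Suc i"] i by simp
    show "\<exists>s\<in>S. s \<notin> (N' # Ds) ! i \<and> (N' # Ds) ! Suc i = insert s ((N' # Ds) ! i) \<or>
        s \<notin> (N' # Ds) ! Suc i \<and> (N' # Ds) ! i = insert s ((N' # Ds) ! Suc i)"
      using d[THEN conjunct1, THEN conjunct2, THEN conjunct2, rule_format, of "Suc i"] i by simp
  qed (use d in auto)
  note fin = reduced_path_last[OF Cons.prems(1)]
  have S: "J \<subseteq> S" "N \<subseteq> S" using fin by (auto simp: finitary_def)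
  define z where "z = coset_max G S p"
  have zp: "z \<in> p" using coset_max_in(1)[OF fin(3,1,2)] z_def by simp
  have zc: "z \<in> carrier G" using double_cosets_eq_dcoset(2)[OF S fin(2) zp] .
  have p': "dcoset J z N' \<in> double_cosets G J N'" "z \<in> dcoset J z N'"
    using zc by (auto intro: dcoset_in_double_cosets dcoset_refl)
  have max: "coset_max G S (dcoset J z N') = coset_max G S p"
    using coset_max_down[OF fin(3,1,2) _ subset_refl p'(1)] p'(2) sub z_def by auto
  have "reduced_step J N N' p (dcoset J z N')"
    using adj sub p'(2) unfolding reduced_step_def z_def by auto
  then have "reduced_path J (Is @ [N]) N' (ps @ [p]) (dcoset J z N')"
    using reduced_path.step[OF Cons.prems(1) fin' p'(1)] by blast
  from Cons.IH[OF this tail] show ?case using max by simp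
qed

lemma reduced_concat:
  assumes p: "p \<in> double_cosets G J I" and fin: "finitary G S J" "finitary G S I"
    and max: "coset_max G S q = coset_max G S p"
    and Is: "expression_for G S Is M N q" "reduced_expression G S Is"
    and As: "ascending_expression G S J M As"
    and Ds: "descending_expression G S N I Ds"
  shows "expression_for G S (As \<circ>\<^sub>e Is \<circ>\<^sub>e Ds) J I p \<and>
         reduced_expression G S (As \<circ>\<^sub>e Is \<circ>\<^sub>e Ds)"
proof -
  obtain qs where qs: "forward_path G S Is qs" "last qs = q"
    using Is(1) by (auto simp: expression_for_def)
  have Is': "Is \<noteq> []" "hd Is = M" "last Is = N" "expression G S Is"
    using Is(1) by (auto simp: expression_for_def expression_def)
  obtain qs' where qs': "forward_path G S Is qs'" "reduced_forward_path Is qs'"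
    using Is(2) unfolding reduced_expression_def reduced_forward_path_iff by blast
  \<comment> \<open>The path witnessing reducedness is the one that ends in \<open>q\<close>.\<close>
  have "qs' = qs" by (rule forward_path_unique[OF Is'(4) qs'(1) qs(1)])
  then have rq: "reduced_forward_path Is qs" using qs' by simp
  then have "qs \<noteq> []" by (auto simp: reduced_forward_path_def)
  then have "reduced_path M (butlast Is) N (butlast qs) q"
    using reduced_forward_path_imp[of "butlast Is" N "butlast qs" q] rq Is' qs(2)
    by (metis append_butlast_last_id hd_conv_nth)
  moreover obtain rs where "reduced_path J (butlast As) M rs (dcoset J \<one> M)"
    using ascending_reduced_path(2)[OF As] by blast
  ultimately obtain ps' p' where p': "reduced_path J (butlast As @ butlast Is) N ps' p'"
    "coset_max G S p' = coset_max G S q"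
    using transfer_reduced_path ascending_reduced_path(1)[OF As] by blast
  obtain Ds' where Ds': "Ds = N # Ds'"
    using Ds by (cases Ds) (auto simp: descending_expression_def expression_def)
  obtain ps r where r: "reduced_path J ((butlast As @ butlast Is) @ butlast Ds) I ps r"
    "coset_max G S r = coset_max G S p'"
    using descending_reduced_path[OF p'(1)] Ds Ds' by blast
  have S: "J \<subseteq> S" "I \<subseteq> S" using fin by (auto simp: finitary_def)
  note rl = reduced_path_last(2)[OF r(1)]
  have "coset_max G S p \<in> r" using coset_max_in(1)[OF fin rl] r(2) p'(2) max by simp
  then have "r = p" using double_cosets_eq[OF S rl p] coset_max_in(1)[OF fin p] by blast
  have As': "As \<noteq> []" "last As = M" using As by (auto simp: ascending_expression_def expression_def)
  have lastD: "last Ds = I" using Ds by (simp add: descending_expression_def)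
  have concat: "Xs \<circ>\<^sub>e Ys = butlast Xs @ Ys" if "Xs \<noteq> []" "Ys \<noteq> []" "last Xs = hd Ys" for Xs Ys :: "'a set list"
    using that unfolding expr_concat_def
    by (metis append.assoc append_Cons append_Nil append_butlast_last_id list.collapse)
  have "Is \<circ>\<^sub>e Ds = butlast Is @ Ds" using concat[OF Is'(1)] Is'(3) Ds' by simp
  moreover have "hd (Is \<circ>\<^sub>e Ds) = M" "Is \<circ>\<^sub>e Ds \<noteq> []"
    using Is' by (auto simp: expr_concat_def)
  ultimately have "As \<circ>\<^sub>e Is \<circ>\<^sub>e Ds = butlast As @ butlast Is @ Ds"
    using concat[OF As'(1)] As'(2) by simp
  also have "\<dots> = ((butlast As @ butlast Is) @ butlast Ds) @ [I]"
    using Ds' lastD by (simp del: butlast.simps last.simps)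
      (metis append_butlast_last_id list.distinct(1))
  finally have eq: "As \<circ>\<^sub>e Is \<circ>\<^sub>e Ds = ((butlast As @ butlast Is) @ butlast Ds) @ [I]" .
  have path: "reduced_forward_path (As \<circ>\<^sub>e Is \<circ>\<^sub>e Ds) (ps @ [p])"
    and hd: "(As \<circ>\<^sub>e Is \<circ>\<^sub>e Ds) ! 0 = J"
    using reduced_path_imp_forward[OF r(1)] \<open>r = p\<close> eq by auto
  then have "hd (As \<circ>\<^sub>e Is \<circ>\<^sub>e Ds) = J" using eq by (simp add: hd_conv_nth)
  moreover have "last (As \<circ>\<^sub>e Is \<circ>\<^sub>e Ds) = I" using eq by simp
  ultimately have "expression_for G S (As \<circ>\<^sub>e Is \<circ>\<^sub>e Ds) J I p"
    using path unfolding reduced_forward_path_iff expression_for_def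
    by (metis last_snoc)
  moreover have "reduced_expression G S (As \<circ>\<^sub>e Is \<circ>\<^sub>e Ds)"
    using path unfolding reduced_forward_path_iff reduced_expression_def by blast
  ultimately show ?thesis by blast
qed

end

theorem proposition4p21:
  fixes G :: "('a, 'b) monoid_scheme" and S I J M N p q :: "'a set"
    and As Is Ds :: "'a set list"
  assumes "coxeter_system G S"
    and "finitary G S I" and "finitary G S J"
    and "p \<in> double_cosets G J I"
    and "M = left_descents G S (coset_max G S p)"
    and "N = right_descents G S (coset_max G S p)"
    and "q \<in> double_cosets G M N"
    and "coset_max G S q = coset_max G S p"
    and "expression_for G S Is M N q" and "reduced_expression G S Is"
    and "ascending_expression G S J M As"
    and "descending_expression G S N I Ds"
  shows "expression_for G S (As \<circ>\<^sub>e Is \<circ>\<^sub>e Ds) J I p \<and>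
         reduced_expression G S (As \<circ>\<^sub>e Is \<circ>\<^sub>e Ds)"
proof -
  interpret group G using assms(1) by (simp add: coxeter_system_def)
  interpret coxeter G S by unfold_locales (rule assms(1))
  show ?thesis by (rule reduced_concat[OF assms(4,3,2,8-12)])
qed

end
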